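(* Let $G$ be a finite non-abelian group with trivial center, let $\chi$ be the character of a faithful irreducible complex representation of $G$ of dimension $n>1$, and let $\gamma_0>\cdots>\gamma_l=0$, $C_q$, $\chi_1,\dots,\chi_k$, $n_i$, $\iota_{i,q}$, $\xi_g$, $c(g)$ and $c_q(g)$ be as defined in the context, with $\gamma_0>0$. Then for every $g\in G$: (i) $\mathbb{E}_{G\times G}(|\xi_g|^t)/n^t\ge c(g)$ for every real $t\ge0$. (ii) $\lim_{t\to\infty}\mathbb{E}_{G\times G}(|\xi_g|^t)/n^t=c(g)$. (iii) There is $q$, $0\le q\le l$ (depending on $g$), such that $$\lim_{t\to\infty}\left(\mathbb{E}_{G\times G}(|\xi_g|^t)/n^t-c(g)\right)^{1/t}=\gamma_q/n,$$ and the functions $\mathbb{E}_{G\times G}(|\xi_g|^t)/n^t-c(g)$ and $c_q(g)(\gamma_q/n)^t$ of $t$ are asymptotically equal as $t\to\infty$. (iv) For all $q=0,\dots,l$, $$c_q(g)=\mathrm{Pr}_{G\times G}(|\xi_g|=\gamma_q)=\frac{1}{|G|}\sum_{i=1}^k\frac{\chi_i(g)}{n_i^2}\,\iota_{i,q}=\frac{1}{|G|}\sum_{h\in C_q}\sum_{i=1}^k\frac{\chi_i(h)\chi_i(g)}{n_i^2}.$$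
   Context: $n>\gamma_0>\gamma_1>\cdots>\gamma_l=0$ is the list of all distinct values of the function $|\chi|:g\mapsto|\chi(g)|$ on $G$; it is a standing assumption that $\gamma_0>0$. $C_q=\{g\in G:|\chi(g)|=\gamma_q\}$, $q=0,\dots,l$. $\chi_1,\dots,\chi_k$ are all the distinct irreducible complex characters of $G$ and $n_i=\chi_i(1)$. $\iota_{i,q}=\sum_{h\in C_q}\chi_i(h)$. $\mathbb{E}_{G\times G}$ and $\mathrm{Pr}_{G\times G}$ denote expectation and probability with respect to the uniform distribution on $G\times G$. $[a,b]$ is the commutator of $a,b$. For $g\in G$, $\xi_g:G\times G\to\mathbb{C}$ is $\xi_g(a,b)=\chi([a,b]^{-1}g)$, and $c(g)=|\{(x,y)\in G\times G:[x,y]=g\}|/|G|^2$. By definition, $c_q(g)=\frac{1}{|G|}\sum_{h\in C_q}\sum_{i=1}^k\frac{\chi_i(h)\chi_i(g)}{n_i^2}$ for $q=0,\dots,l$. Convention for $t=0$: $0^0=0$. Two functions $f,h$ of $t$ are asymptotically equal if $f(t)=h(t)(1+\varepsilon(t))$ for all large $t$ with $\varepsilon(t)\to0$ as $t\to\infty$ (in particular two functions vanishing for all large $t$ are asymptotically equal). *)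

theory Defs
  imports
    "HOL-Probability.Probability"
    "HOL-Library.Landau_Symbols"
    "Jordan_Normal_Form.VS_Connect"
begin

definition center :: "('g, 'm) monoid_scheme \<Rightarrow> 'g set" where
  "center G = {z \<in> carrier G. \<forall>g\<in>carrier G. z \<otimes>\<^bsub>G\<^esub> g = g \<otimes>\<^bsub>G\<^esub> z}"

(* Same convention as derived_set in HOL-Algebra.Generated_Groups. *)
definition commutator :: "('g, 'm) monoid_scheme \<Rightarrow> 'g \<Rightarrow> 'g \<Rightarrow> 'g" where
  "commutator G a b = a \<otimes>\<^bsub>G\<^esub> b \<otimes>\<^bsub>G\<^esub> inv\<^bsub>G\<^esub> a \<otimes>\<^bsub>G\<^esub> inv\<^bsub>G\<^esub> b"

definition GL :: "nat \<Rightarrow> complex mat monoid" where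
  "GL n = units_of (ring_mat TYPE(complex) n ())"

definition irreducible_rep :: "('g, 'm) monoid_scheme \<Rightarrow> nat \<Rightarrow> ('g \<Rightarrow> complex mat) \<Rightarrow> bool" where
  "irreducible_rep G n \<rho> \<longleftrightarrow> \<rho> \<in> hom G (GL n) \<and> n > 0 \<and>
     (\<forall>W. subspace class_ring W (module_vec TYPE(complex) n) \<and>
          (\<forall>g\<in>carrier G. \<forall>w\<in>W. \<rho> g *\<^sub>v w \<in> W)
        \<longrightarrow> W = {0\<^sub>v n} \<or> W = carrier_vec n)"

definition mat_trace :: "'a::comm_monoid_add mat \<Rightarrow> 'a" where
  "mat_trace A = (\<Sum>i<dim_row A. A $$ (i, i))"

(* The character is made undefined outside the carrier, so that equality of characters as
   HOL functions is equality of characters on the group, and "distinct" irreducible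
   characters below are counted correctly. *)
definition character :: "('g, 'm) monoid_scheme \<Rightarrow> ('g \<Rightarrow> complex mat) \<Rightarrow> 'g \<Rightarrow> complex" where
  "character G \<rho> = (\<lambda>g\<in>carrier G. mat_trace (\<rho> g))"

definition irreducible_characters :: "('g, 'm) monoid_scheme \<Rightarrow> ('g \<Rightarrow> complex) set" where
  "irreducible_characters G = {character G \<rho> | n \<rho>. irreducible_rep G n \<rho>}"

definition xi :: "('g, 'm) monoid_scheme \<Rightarrow> ('g \<Rightarrow> complex) \<Rightarrow> 'g \<Rightarrow> 'g \<times> 'g \<Rightarrow> complex" where
  "xi G chi g = (\<lambda>(a, b). chi (inv\<^bsub>G\<^esub> (commutator G a b) \<otimes>\<^bsub>G\<^esub> g))"

definition commutator_density :: "('g, 'm) monoid_scheme \<Rightarrow> 'g \<Rightarrow> real" where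
  "commutator_density G g =
     real (card {(x, y) \<in> carrier G \<times> carrier G. commutator G x y = g}) / (real (order G))\<^sup>2"

definition modulus_class ::
    "('g, 'm) monoid_scheme \<Rightarrow> ('g \<Rightarrow> complex) \<Rightarrow> (nat \<Rightarrow> real) \<Rightarrow> nat \<Rightarrow> 'g set" where
  "modulus_class G chi \<gamma> q = {g \<in> carrier G. cmod (chi g) = \<gamma> q}"

definition iota ::
    "('g, 'm) monoid_scheme \<Rightarrow> ('g \<Rightarrow> complex) \<Rightarrow> (nat \<Rightarrow> real) \<Rightarrow>
     (nat \<Rightarrow> 'g \<Rightarrow> complex) \<Rightarrow> nat \<Rightarrow> nat \<Rightarrow> complex" where
  "iota G chi \<gamma> \<psi> i q = (\<Sum>h\<in>modulus_class G chi \<gamma> q. \<psi> i h)"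

(* The enumeration \<psi> 1, ..., \<psi> k of the irreducible characters is a parameter; their degrees
   are the (complex) values at the unit element. *)
definition c_coeff ::
    "('g, 'm) monoid_scheme \<Rightarrow> ('g \<Rightarrow> complex) \<Rightarrow> (nat \<Rightarrow> real) \<Rightarrow>
     nat \<Rightarrow> (nat \<Rightarrow> 'g \<Rightarrow> complex) \<Rightarrow> nat \<Rightarrow> 'g \<Rightarrow> complex" where
  "c_coeff G chi \<gamma> k \<psi> q g =
     1 / of_nat (order G) *
       (\<Sum>h\<in>modulus_class G chi \<gamma> q. \<Sum>i=1..k. \<psi> i h * \<psi> i g / (\<psi> i \<one>\<^bsub>G\<^esub>)\<^sup>2)"

abbreviation uniform_pairs :: "('g, 'm) monoid_scheme \<Rightarrow> ('g \<times> 'g) pmf" where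
  "uniform_pairs G \<equiv> pmf_of_set (carrier G \<times> carrier G)"

(* The moment E(|xi_g|^t) / n^t. Since 0 powr t = 0 for all t, including t = 0, and
   x powr 0 = 1 for x > 0, powr realises the convention 0^0 = 0. *)
definition normalized_moment ::
    "('g, 'm) monoid_scheme \<Rightarrow> ('g \<Rightarrow> complex) \<Rightarrow> nat \<Rightarrow> 'g \<Rightarrow> real \<Rightarrow> real" where
  "normalized_moment G chi n g t =
     measure_pmf.expectation (uniform_pairs G) (\<lambda>p. cmod (xi G chi g p) powr t) / real n powr t"

(* Library asymptotic equivalence treats 0/0 as 1, so it is the relation f = h (1 + eps)
   eventually, with eps tending to 0, also when f and h vanish. *)
lemma asymp_equiv_iff_eps:
  fixes f h :: "real \<Rightarrow> complex"
  shows "f \<sim>[at_top] h \<longleftrightarrow>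
    (\<exists>\<epsilon>. (\<forall>\<^sub>F t in at_top. f t = h t * (1 + \<epsilon> t)) \<and> (\<epsilon> \<longlongrightarrow> 0) at_top)"
proof
  assume eq: "f \<sim>[at_top] h"
  let ?r = "\<lambda>t. if f t = 0 \<and> h t = 0 then 1 else f t / h t"
  have lim: "(?r \<longlongrightarrow> 1) at_top" using eq by (simp add: asymp_equiv_def)
  have "\<forall>\<^sub>F t in at_top. f t = h t * (1 + (?r t - 1))"
    using asymp_equiv_eventually_zeros[OF eq] by eventually_elim auto
  moreover have "((\<lambda>t. ?r t - 1) \<longlongrightarrow> 0) at_top" using tendsto_diff[OF lim tendsto_const[of 1]] by simp
  ultimately show "\<exists>\<epsilon>. (\<forall>\<^sub>F t in at_top. f t = h t * (1 + \<epsilon> t)) \<and> (\<epsilon> \<longlongrightarrow> 0) at_top"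
    by (intro exI[of _ "\<lambda>t. ?r t - 1"] conjI)
next
  assume "\<exists>\<epsilon>. (\<forall>\<^sub>F t in at_top. f t = h t * (1 + \<epsilon> t)) \<and> (\<epsilon> \<longlongrightarrow> 0) at_top"
  then obtain \<epsilon> where e: "\<forall>\<^sub>F t in at_top. f t = h t * (1 + \<epsilon> t)" "(\<epsilon> \<longlongrightarrow> 0) at_top" by blast
  let ?r = "\<lambda>t. if f t = 0 \<and> h t = 0 then 1 else f t / h t"
  have "((\<lambda>t. if h t = 0 then 1 else 1 + \<epsilon> t) \<longlongrightarrow> 1) at_top"
  proof -
    have "((\<lambda>t. if h t = 0 then 0 else \<epsilon> t) \<longlongrightarrow> 0) at_top"
      by (rule Lim_null_comparison[OF _ tendsto_norm_zero[OF e(2)]]) simp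
    from tendsto_add[OF tendsto_const[of 1] this] show ?thesis
      by (simp add: if_distrib cong: if_cong)
  qed
  moreover have "\<forall>\<^sub>F t in at_top. (if h t = 0 then 1 else 1 + \<epsilon> t) = ?r t"
    using e(1) by eventually_elim auto
  ultimately show "f \<sim>[at_top] h"
    unfolding asymp_equiv_def by (rule Lim_transform_eventually)
qed

end

theory Submission
  imports
    Defs
    "HOL-Library.Function_Algebras"
    "HOL-Algebra.Multiplicative_Group"
    "HOL-Real_Asymp.Real_Asymp"
    "Jordan_Normal_Form.Schur_Decomposition"
    "Jordan_Normal_Form.Spectral_Radius"
begin

text \<open>
  For a uniformly random pair \<open>(a, b)\<close>, the element \<open>[a,b]\<inverse>g\<close> equals \<open>h\<close> exactly when
  \<open>[a,b] = gh\<inverse>\<close>.  So everything is governed by the distribution of commutators, which is given by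
  Frobenius' formula: the number of pairs with \<open>[a,b] = x\<close> is \<open>|G| \<Sum>\<^sub>i \<chi>\<^sub>i(x) / n\<^sub>i\<close>
  (\<open>frobenius_commutator_formula\<close>).  Sum this formula over \<open>x = gh\<inverse>\<close> with \<open>h\<close> in a level set
  \<open>C\<^sub>q\<close> of \<open>|\<chi>|\<close>.  The set \<open>C\<^sub>q\<close> is closed under inversion and conjugation, so \<open>gh\<inverse>\<close> may be
  replaced first by \<open>gh\<close> and then by the average of \<open>g(aha\<inverse>)\<close> over \<open>a\<close>; the irreducible
  character \<open>\<chi>\<^sub>i\<close> sends this average to \<open>\<chi>\<^sub>i(g)\<chi>\<^sub>i(h)/n\<^sub>i\<close>.  This is the identity between \<open>c\<^sub>q(g)\<close> and the
  probability that \<open>|\<xi>\<^sub>g| = \<gamma>\<^sub>q\<close> (\<open>card_commutator_translate\<close>).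

  Splitting the expectation by the values of \<open>|\<xi>\<^sub>g|\<close> turns the normalised moment into
  \<open>P(|\<xi>\<^sub>g| = n) + \<Sum>\<^sub>q c\<^sub>q(g) (\<gamma>\<^sub>q/n)\<^sup>t\<close>.  In a faithful irreducible representation a group element with
  \<open>|\<chi>(h)| = n\<close> acts as a scalar, hence is central, hence trivial; so the first summand is \<open>c(g)\<close>.
  The remaining sum has bases in \<open>[0,1)\<close>, and its behaviour for large
  \<open>t\<close> is that of the first term with nonzero coefficient (\<open>powr_sum_leading_term\<close>).  If every
  coefficient with \<open>q < l\<close> vanishes, the sum is identically zero, and \<open>q = l\<close> serves because \<open>\<gamma>\<^sub>l = 0\<close>.

  Frobenius' formula holds because its two sides are class functions with the same inner product with
  each irreducible character: the right side by the orthogonality relations, the left side because the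
  average of \<open>\<chi>\<^sub>i(aba\<inverse>y)\<close> over \<open>a\<close> is \<open>\<chi>\<^sub>i(b)\<chi>\<^sub>i(y)/n\<^sub>i\<close>.  Both computations come from Schur's lemma, via
  the averaged matrix coefficients.  What remains is that a class function orthogonal to all
  irreducible characters vanishes
  (\<open>class_function_eq_0_if_orthogonal_to_irreducible_characters\<close>).
\<close>

section \<open>Schur's lemma\<close>

text \<open>The dollar sign is wanted here only for the entries of vectors of variable dimension.\<close>
unbundle no vec_syntax

lemma subspace_vec_iff:
  "subspace class_ring W (module_vec TYPE(complex) n) \<longleftrightarrow>
     W \<subseteq> carrier_vec n \<and> 0\<^sub>v n \<in> W \<and> (\<forall>v\<in>W. \<forall>w\<in>W. v + w \<in> W) \<and> (\<forall>c. \<forall>v\<in>W. c \<cdot>\<^sub>v v \<in> W)"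
proof -
  have V: "vectorspace class_ring (module_vec TYPE(complex) n)"
    by (rule vec_vs)
  hence M: "module class_ring (module_vec TYPE(complex) n)"
    by (simp add: vectorspace_def)
  show ?thesis
    using V M
    by (auto simp: subspace_def submodule_def module_vec_simps class_ring_simps)
qed

lemma mat_trace_mult_comm:
  fixes A B :: "'a::comm_semiring_0 mat"
  assumes "A \<in> carrier_mat n m" "B \<in> carrier_mat m n"
  shows "mat_trace (A * B) = mat_trace (B * A)"
proof -
  have "mat_trace (A * B) = (\<Sum>i<n. \<Sum>j<m. A $$ (i,j) * B $$ (j,i))"
    using assms by (auto simp: mat_trace_def scalar_prod_def atLeast0LessThan)
  also have "\<dots> = (\<Sum>j<m. \<Sum>i<n. B $$ (j,i) * A $$ (i,j))"
    by (subst sum.swap) (simp add: mult.commute)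
  also have "\<dots> = mat_trace (B * A)"
    using assms by (auto simp: mat_trace_def scalar_prod_def atLeast0LessThan)
  finally show ?thesis .
qed

lemma mat_mult_entry:
  assumes "A \<in> carrier_mat n m" "B \<in> carrier_mat m p" "i < n" "j < p"
  shows "(A * B) $$ (i, j) = (\<Sum>k<m. A $$ (i, k) * B $$ (k, j))"
  using assms by (auto simp: scalar_prod_def atLeast0LessThan)

lemma index_eq_mult_unit_vec:
  fixes A :: "'a::semiring_1 mat"
  assumes "A \<in> carrier_mat n m" "i < n" "j < m"
  shows "A $$ (i, j) = (A *\<^sub>v unit_vec m j) $ i"
proof -
  have "(A *\<^sub>v unit_vec m j) $ i = (\<Sum>k\<in>{0..<m}. A $$ (i, k) * (if k = j then 1 else 0))"
    using assms by (auto simp: scalar_prod_def intro!: sum.cong)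
  also have "\<dots> = (\<Sum>k\<in>{0..<m}. if k = j then A $$ (i, k) else 0)"
    by (intro sum.cong) auto
  also have "\<dots> = A $$ (i, j)" using assms by (simp add: sum.delta)
  finally show ?thesis by simp
qed

lemma eq_scalar_mat_if_mult_vec:
  fixes M :: "complex mat"
  assumes M: "M \<in> carrier_mat n n" and v: "\<And>v. v \<in> carrier_vec n \<Longrightarrow> M *\<^sub>v v = c \<cdot>\<^sub>v v"
  shows "M = c \<cdot>\<^sub>m 1\<^sub>m n"
proof (rule eq_matI)
  fix i j assume ij: "i < dim_row (c \<cdot>\<^sub>m 1\<^sub>m n)" "j < dim_col (c \<cdot>\<^sub>m 1\<^sub>m n :: complex mat)"
  have "M $$ (i, j) = (M *\<^sub>v unit_vec n j) $ i"
    using M ij by (intro index_eq_mult_unit_vec) auto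
  also have "\<dots> = (c \<cdot>\<^sub>m 1\<^sub>m n) $$ (i, j)" using ij by (simp add: v)
  finally show "M $$ (i, j) = (c \<cdot>\<^sub>m 1\<^sub>m n) $$ (i, j)" .
qed (use M in auto)

lemma irreducible_repD:
  assumes "group G" "irreducible_rep G n \<rho>"
  shows "n > 0"
    and "\<And>x. x \<in> carrier G \<Longrightarrow> \<rho> x \<in> carrier_mat n n"
    and "\<And>x y. x \<in> carrier G \<Longrightarrow> y \<in> carrier G \<Longrightarrow> \<rho> (x \<otimes>\<^bsub>G\<^esub> y) = \<rho> x * \<rho> y"
    and "\<rho> \<one>\<^bsub>G\<^esub> = 1\<^sub>m n"
proof -
  interpret G: group G by fact
  interpret R: ring "ring_mat TYPE(complex) n ()" by (rule ring_mat)
  have hom: "\<rho> \<in> hom G (GL n)" and n: "n > 0" using assms by (auto simp: irreducible_rep_def)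
  have gl: "group (GL n)" unfolding GL_def by (rule R.units_group)
  show "n > 0" by (rule n)
  show "\<And>x. x \<in> carrier G \<Longrightarrow> \<rho> x \<in> carrier_mat n n"
    using hom by (auto simp: hom_def GL_def units_of_carrier Units_def ring_mat_simps)
  show "\<And>x y. x \<in> carrier G \<Longrightarrow> y \<in> carrier G \<Longrightarrow> \<rho> (x \<otimes>\<^bsub>G\<^esub> y) = \<rho> x * \<rho> y"
    using hom by (auto simp: hom_def GL_def units_of_mult ring_mat_simps)
  interpret h: group_hom G "GL n" \<rho>
    using gl hom by (simp add: group_hom_def group_hom_axioms_def G.group_axioms)
  show "\<rho> \<one>\<^bsub>G\<^esub> = 1\<^sub>m n"
    using h.hom_one by (simp add: GL_def units_of_one ring_mat_simps)
qed

lemma irreducible_rep_invariant: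
  assumes "irreducible_rep G n \<rho>" "W \<subseteq> carrier_vec n" "0\<^sub>v n \<in> W"
    and "\<And>v w. v \<in> W \<Longrightarrow> w \<in> W \<Longrightarrow> v + w \<in> W" "\<And>c v. v \<in> W \<Longrightarrow> c \<cdot>\<^sub>v v \<in> W"
    and "\<And>x w. x \<in> carrier G \<Longrightarrow> w \<in> W \<Longrightarrow> \<rho> x *\<^sub>v w \<in> W"
  shows "W = {0\<^sub>v n} \<or> W = carrier_vec n"
proof -
  have "subspace class_ring W (module_vec TYPE(complex) n)"
    unfolding subspace_vec_iff by (intro conjI ballI allI assms(2-5))
  thus ?thesis using assms(1,6) unfolding irreducible_rep_def by simp
qed

text \<open>
  An eigenspace of \<open>M\<close> is invariant under the representation and nonzero, so it is the whole space.
  The scalar is recovered from the trace.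
\<close>
lemma schur_endomorphism_scalar:
  assumes "group G" "irreducible_rep G n \<rho>" and M: "M \<in> carrier_mat n n"
    and comm: "\<And>x. x \<in> carrier G \<Longrightarrow> \<rho> x * M = M * \<rho> x"
  shows "M = (mat_trace M / of_nat n) \<cdot>\<^sub>m 1\<^sub>m n"
proof -
  note r = irreducible_repD[OF assms(1,2)]
  from spectrum_non_empty[OF M r(1)] obtain c where c: "eigenvalue M c"
    by (auto simp: spectrum_def)
  then obtain u where u: "u \<in> carrier_vec n" "u \<noteq> 0\<^sub>v n" "M *\<^sub>v u = c \<cdot>\<^sub>v u"
    using M by (auto simp: eigenvalue_def eigenvector_def)
  define W where "W = {v \<in> carrier_vec n. M *\<^sub>v v = c \<cdot>\<^sub>v v}"
  have "W = {0\<^sub>v n} \<or> W = carrier_vec n"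
  proof (rule irreducible_rep_invariant[OF assms(2)])
    show "0\<^sub>v n \<in> W" using M by (auto simp: W_def)
    show "v + w \<in> W" if "v \<in> W" "w \<in> W" for v w
      using that M by (auto simp: W_def mult_add_distrib_mat_vec smult_add_distrib_vec)
    show "d \<cdot>\<^sub>v v \<in> W" if "v \<in> W" for d v
      using that M by (auto simp: W_def mult_mat_vec smult_smult_assoc mult.commute)
    show "\<rho> x *\<^sub>v w \<in> W" if "x \<in> carrier G" "w \<in> W" for x w
    proof -
      have w: "w \<in> carrier_vec n" "M *\<^sub>v w = c \<cdot>\<^sub>v w" using that by (auto simp: W_def)
      have "M *\<^sub>v (\<rho> x *\<^sub>v w) = (M * \<rho> x) *\<^sub>v w"
        using M r(2)[OF that(1)] w by simp
      also have "\<dots> = \<rho> x *\<^sub>v (M *\<^sub>v w)"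
        using M r(2)[OF that(1)] w by (simp add: comm[OF that(1), symmetric])
      also have "\<dots> = c \<cdot>\<^sub>v (\<rho> x *\<^sub>v w)"
        using M r(2)[OF that(1)] w by (simp add: mult_mat_vec)
      finally show ?thesis using w r(2)[OF that(1)] by (auto simp: W_def)
    qed
  qed (auto simp: W_def)
  moreover have "u \<in> W" using u by (simp add: W_def)
  ultimately have "W = carrier_vec n" using u by auto
  hence eq: "M = c \<cdot>\<^sub>m 1\<^sub>m n" by (intro eq_scalar_mat_if_mult_vec M) (auto simp: W_def)
  have "mat_trace M = of_nat n * c"
    by (subst eq) (auto simp: mat_trace_def)
  thus ?thesis using eq r(1) by simp
qed

text \<open>
  The kernel and the image of \<open>B\<close> are invariant, so \<open>B\<close> is bijective and conjugates one
  representation into the other.  The inverse \<open>C\<close> is built as a right inverse, column by column, from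
  surjectivity; injectivity then makes it a left inverse.  In this way the equality of the traces
  follows without a prior proof that the dimensions agree.
\<close>
lemma schur_intertwiner:
  assumes "group G" "irreducible_rep G n \<rho>" "irreducible_rep G m \<sigma>"
    and B: "B \<in> carrier_mat n m"
    and comm: "\<And>x. x \<in> carrier G \<Longrightarrow> \<rho> x * B = B * \<sigma> x"
    and nz: "B \<noteq> 0\<^sub>m n m"
  shows "character G \<rho> = character G \<sigma>"
proof -
  note r = irreducible_repD[OF assms(1,2)]
  note s = irreducible_repD[OF assms(1,3)]
  define W where "W = {v \<in> carrier_vec m. B *\<^sub>v v = 0\<^sub>v n}"
  define U where "U = {B *\<^sub>v v |v. v \<in> carrier_vec m}"
  have swap: "B *\<^sub>v (\<sigma> x *\<^sub>v w) = \<rho> x *\<^sub>v (B *\<^sub>v w)"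
    if "x \<in> carrier G" "w \<in> carrier_vec m" for x w
  proof -
    have "B *\<^sub>v (\<sigma> x *\<^sub>v w) = (B * \<sigma> x) *\<^sub>v w" using B s(2)[OF that(1)] that by simp
    also have "\<dots> = \<rho> x *\<^sub>v (B *\<^sub>v w)"
      using B r(2)[OF that(1)] that by (simp add: comm[OF that(1), symmetric])
    finally show ?thesis .
  qed
  have "W = {0\<^sub>v m} \<or> W = carrier_vec m"
  proof (rule irreducible_rep_invariant[OF assms(3)])
    show "0\<^sub>v m \<in> W" using B by (auto simp: W_def)
    show "v + w \<in> W" if "v \<in> W" "w \<in> W" for v w
      using that B by (auto simp: W_def mult_add_distrib_mat_vec)
    show "d \<cdot>\<^sub>v v \<in> W" if "v \<in> W" for d v
      using that B by (auto simp: W_def mult_mat_vec)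
    show "\<sigma> x *\<^sub>v w \<in> W" if "x \<in> carrier G" "w \<in> W" for x w
      using that B s(2)[OF that(1)] r(2)[OF that(1)] by (auto simp: W_def swap)
  qed (auto simp: W_def)
  have "U = {0\<^sub>v n} \<or> U = carrier_vec n"
  proof (rule irreducible_rep_invariant[OF assms(2)])
    show "0\<^sub>v n \<in> U" using B by (auto simp: U_def intro!: exI[of _ "0\<^sub>v m"])
    show "v + w \<in> U" if "v \<in> U" "w \<in> U" for v w
    proof -
      from that obtain v' w' where "v = B *\<^sub>v v'" "w = B *\<^sub>v w'" "v' \<in> carrier_vec m" "w' \<in> carrier_vec m"
        by (auto simp: U_def)
      thus ?thesis using B by (auto simp: U_def mult_add_distrib_mat_vec intro!: exI[of _ "v' + w'"])
    qed
    show "d \<cdot>\<^sub>v v \<in> U" if "v \<in> U" for d v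
    proof -
      from that obtain v' where "v = B *\<^sub>v v'" "v' \<in> carrier_vec m" by (auto simp: U_def)
      thus ?thesis using B by (auto simp: U_def mult_mat_vec intro!: exI[of _ "d \<cdot>\<^sub>v v'"])
    qed
    show "\<rho> x *\<^sub>v w \<in> U" if "x \<in> carrier G" "w \<in> U" for x w
    proof -
      from that obtain v' where "w = B *\<^sub>v v'" "v' \<in> carrier_vec m" by (auto simp: U_def)
      thus ?thesis using that swap[OF that(1), of v'] s(2)[OF that(1)]
        by (auto simp: U_def intro!: exI[of _ "\<sigma> x *\<^sub>v v'"])
    qed
  qed (use B in \<open>auto simp: U_def\<close>)
  have ex: "\<exists>v\<in>carrier_vec m. B *\<^sub>v v \<noteq> 0\<^sub>v n"
  proof (rule ccontr)
    assume a: "\<not> ?thesis"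
    have "B $$ (i, j) = 0" if "i < n" "j < m" for i j
    proof -
      have "B $$ (i, j) = (B *\<^sub>v unit_vec m j) $ i" using B that by (intro index_eq_mult_unit_vec) auto
      thus ?thesis using a that by simp
    qed
    hence "B = 0\<^sub>m n m" using B by (intro eq_matI) auto
    thus False using nz by simp
  qed
  have W: "W = {0\<^sub>v m}" using \<open>W = {0\<^sub>v m} \<or> _\<close> ex by (auto simp: W_def)
  have U: "U = carrier_vec n" using \<open>U = {0\<^sub>v n} \<or> _\<close> ex by (auto simp: U_def)
  have "\<forall>i<n. \<exists>v\<in>carrier_vec m. B *\<^sub>v v = unit_vec n i"
  proof (intro allI impI)
    fix i assume "i < n"
    have "unit_vec n i \<in> U" unfolding U by simp
    thus "\<exists>v\<in>carrier_vec m. B *\<^sub>v v = unit_vec n i" by (auto simp: U_def)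
  qed
  then obtain c where c: "\<And>i. i < n \<Longrightarrow> c i \<in> carrier_vec m" "\<And>i. i < n \<Longrightarrow> B *\<^sub>v c i = unit_vec n i"
    by metis
  define C where "C = mat_of_cols m (map c [0..<n])"
  have C: "C \<in> carrier_mat m n" by (simp add: C_def mat_of_cols_def)
  have colC: "col C i = c i" if "i < n" for i
    using that c unfolding C_def by (subst col_mat_of_cols) auto
  have BC: "B * C = 1\<^sub>m n"
  proof (rule mat_col_eqI)
    fix i assume i: "i < dim_col (1\<^sub>m n :: complex mat)"
    have "col (B * C) i = B *\<^sub>v col C i" using i by (intro col_mult2[OF B C]) auto
    thus "col (B * C) i = col (1\<^sub>m n) i" using i by (simp add: colC c)
  qed (use B C in auto)
  have CB: "C * B = 1\<^sub>m m"
  proof -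
    have "(C * B) *\<^sub>v v = 1 \<cdot>\<^sub>v v" if v: "v \<in> carrier_vec m" for v
    proof -
      have "B *\<^sub>v ((C * B) *\<^sub>v v) = (B * C) *\<^sub>v (B *\<^sub>v v)"
        using B C v by (simp add: assoc_mult_mat_vec[of _ n m _ n] assoc_mult_mat_vec[of _ m n _ m])
      hence "B *\<^sub>v ((C * B) *\<^sub>v v - v) = 0\<^sub>v n"
        using B C v by (simp add: BC mult_minus_distrib_mat_vec)
      hence "(C * B) *\<^sub>v v - v \<in> W" using B C v by (auto simp: W_def)
      hence d: "(C * B) *\<^sub>v v - v = 0\<^sub>v m" unfolding W by simp
      have "((C * B) *\<^sub>v v) $ i = v $ i" if "i < m" for i
      proof -
        have "((C * B) *\<^sub>v v - v) $ i = 0" using d that by simp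
        thus ?thesis using that v B C by simp
      qed
      thus ?thesis using B C v by (intro eq_vecI) auto
    qed
    hence "C * B = 1 \<cdot>\<^sub>m 1\<^sub>m m" using B C by (intro eq_scalar_mat_if_mult_vec) auto
    also have "\<dots> = 1\<^sub>m m" by (rule eq_matI) auto
    finally show ?thesis .
  qed
  have "mat_trace (\<rho> x) = mat_trace (\<sigma> x)" if x: "x \<in> carrier G" for x
  proof -
    have "\<rho> x = (\<rho> x * B) * C"
      using r(2)[OF x] by (subst assoc_mult_mat[OF r(2)[OF x] B C]) (simp add: BC)
    hence "mat_trace (\<rho> x) = mat_trace ((\<rho> x * B) * C)" by (rule arg_cong)
    also have "\<dots> = mat_trace ((B * \<sigma> x) * C)" by (simp only: comm[OF x])
    also have "\<dots> = mat_trace (C * (B * \<sigma> x))"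
      using B C s(2)[OF x] by (intro mat_trace_mult_comm[of _ n m]) auto
    also have "C * (B * \<sigma> x) = \<sigma> x"
      using s(2)[OF x] by (subst assoc_mult_mat[OF C B s(2)[OF x], symmetric]) (simp add: CB)
    finally show ?thesis .
  qed
  thus ?thesis unfolding character_def by (rule restrict_ext)
qed

section \<open>Matrices of finite order\<close>

lemma upper_triangular_mult:
  fixes A B :: "complex mat"
  assumes A: "A \<in> carrier_mat n n" "upper_triangular A" and B: "B \<in> carrier_mat n n" "upper_triangular B"
  shows "upper_triangular (A * B)"
    and "i < n \<Longrightarrow> (A * B) $$ (i, i) = A $$ (i, i) * B $$ (i, i)"
proof -
  show "upper_triangular (A * B)"
  proof (rule upper_triangularI)
    fix i j assume ij: "j < i" "i < dim_row (A * B)"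
    have "A $$ (i, k) * B $$ (k, j) = 0" if "k < n" for k
    proof (cases "k < i")
      case True
      thus ?thesis using upper_triangularD[OF A(2), of k i] ij A by simp
    next
      case False
      thus ?thesis using upper_triangularD[OF B(2), of j k] ij B that by simp
    qed
    thus "(A * B) $$ (i, j) = 0"
      using ij A B by (subst mat_mult_entry[of _ n n _ n]) (auto intro!: sum.neutral)
  qed
  assume i: "i < n"
  have "A $$ (i, k) * B $$ (k, i) = 0" if "k < n" "k \<noteq> i" for k
  proof (cases "k < i")
    case True
    thus ?thesis using upper_triangularD[OF A(2), of k i] i A by simp
  next
    case False
    thus ?thesis using upper_triangularD[OF B(2), of i k] i B that by simp
  qed
  hence "(\<Sum>k<n. A $$ (i, k) * B $$ (k, i)) = (\<Sum>k\<in>{i}. A $$ (i, k) * B $$ (k, i))"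
    using i by (intro sum.mono_neutral_right) auto
  thus "(A * B) $$ (i, i) = A $$ (i, i) * B $$ (i, i)"
    using i A B by (subst mat_mult_entry[of _ n n _ n]) auto
qed

lemma upper_triangular_pow:
  fixes B :: "complex mat"
  assumes B: "B \<in> carrier_mat n n" "upper_triangular B"
  shows "upper_triangular (B ^\<^sub>m k) \<and> (\<forall>i<n. (B ^\<^sub>m k) $$ (i, i) = (B $$ (i, i)) ^ k)"
proof (induction k)
  case 0
  show ?case using B by (auto intro: upper_triangularI)
next
  case (Suc k)
  have P: "B ^\<^sub>m k \<in> carrier_mat n n" using B by simp
  show ?case
    using upper_triangular_mult[OF P _ B] Suc.IH by auto
qed

text \<open>
  Equality in the triangle inequality: with \<open>u\<close> the mean of the \<open>z\<^sub>i\<close>, which is again of modulus one, the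
  real parts of \<open>z\<^sub>i u\<^sup>*\<close> are at most one and have sum \<open>n\<close>.
\<close>
lemma unimodular_sum_max:
  fixes z :: "nat \<Rightarrow> complex"
  assumes z: "\<And>i. i < n \<Longrightarrow> cmod (z i) = 1" and s: "cmod (\<Sum>i<n. z i) = real n" and "i < n"
  shows "z i = (\<Sum>i<n. z i) / of_nat n"
proof -
  define s where "s = (\<Sum>i<n. z i)"
  define u where "u = s / of_nat n"
  have n: "n > 0" using \<open>i < n\<close> by simp
  have u: "cmod u = 1" using n s by (simp add: u_def s_def norm_divide)
  have uu: "u * cnj u = 1" using u by (simp add: complex_norm_square[symmetric])
  have le: "Re (z j * cnj u) \<le> 1" if "j < n" for j
    using complex_Re_le_cmod[of "z j * cnj u"] z[OF that] u by (simp add: norm_mult)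
  have "(\<Sum>j<n. z j * cnj u) = of_nat n * (u * cnj u)"
    using n unfolding sum_distrib_right[symmetric] s_def[symmetric] by (simp add: u_def)
  hence "(\<Sum>j<n. Re (z j * cnj u)) = real n"
    unfolding uu by (metis Re_sum mult.right_neutral of_nat_0_le_iff complex_Re_of_nat)
  hence sum0: "(\<Sum>j<n. 1 - Re (z j * cnj u)) = 0" by (simp add: sum_subtractf)
  have "1 - Re (z i * cnj u) = 0"
    using sum0 le \<open>i < n\<close> by (subst (asm) sum_nonneg_eq_0_iff) auto
  hence re: "Re (z i * cnj u) = 1" by simp
  have "cmod (z i * cnj u) = 1" using z[OF \<open>i < n\<close>] u by (simp add: norm_mult)
  hence "(Re (z i * cnj u))\<^sup>2 + (Im (z i * cnj u))\<^sup>2 = 1"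
    by (simp add: cmod_def del: times_complex.sel)
  hence "Im (z i * cnj u) = 0" unfolding re by simp
  hence "z i * cnj u = 1" using re by (simp add: complex_eq_iff)
  hence "z i * (u * cnj u) = u" by (metis mult.assoc mult.commute mult_1)
  hence "z i = u" unfolding uu by simp
  thus ?thesis unfolding u_def s_def .
qed

text \<open>
  Back substitution, entry by entry along each row of \<open>D\<close>.
\<close>
lemma mult_upper_triangular_eq_0:
  fixes D S :: "complex mat"
  assumes D: "D \<in> carrier_mat n n" and S: "S \<in> carrier_mat n n" "upper_triangular S"
    and diag: "\<And>j. j < n \<Longrightarrow> S $$ (j, j) \<noteq> 0" and 0: "D * S = 0\<^sub>m n n"
  shows "D = 0\<^sub>m n n"
proof -
  have "D $$ (i, j) = 0" if "i < n" "j < n" for i j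
    using that(2)
  proof (induction j rule: less_induct)
    case (less j)
    have "(\<Sum>k<n. D $$ (i, k) * S $$ (k, j)) = (D * S) $$ (i, j)"
      using D S that less.prems by (subst mat_mult_entry[of _ n n _ n]) auto
    also have "\<dots> = 0" using 0 that less.prems by simp
    also have "(\<Sum>k<n. D $$ (i, k) * S $$ (k, j)) = (\<Sum>k\<in>{j}. D $$ (i, k) * S $$ (k, j))"
    proof (rule sum.mono_neutral_right)
      show "\<forall>k\<in>{..<n} - {j}. D $$ (i, k) * S $$ (k, j) = 0"
      proof
        fix k assume k: "k \<in> {..<n} - {j}"
        show "D $$ (i, k) * S $$ (k, j) = 0"
        proof (cases "k < j")
          case True
          thus ?thesis using less by simp
        next
          case False
          hence "j < k" "k < dim_row S" using k S by auto
          thus ?thesis using upper_triangularD[OF S(2)] by simp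
        qed
      qed
    qed (use less.prems in auto)
    finally show ?case using diag[OF less.prems] by simp
  qed
  thus ?thesis using D by (intro eq_matI) auto
qed

text \<open>
  The upper triangular matrix \<open>S = \<Sum>\<^sub>k (B/c)\<^sup>k\<close>, with \<open>k < N\<close>, has \<open>N\<close> in every diagonal position, and
  \<open>(B/c - 1) S = (B/c)\<^sup>N - 1 = 0\<close> by telescoping.  So \<open>B/c - 1 = 0\<close>.
\<close>
lemma finite_order_upper_triangular_scalar:
  fixes B :: "complex mat"
  assumes B: "B \<in> carrier_mat n n" "upper_triangular B" and N: "B ^\<^sub>m N = 1\<^sub>m n" "N > 0"
    and diag: "\<And>i. i < n \<Longrightarrow> B $$ (i, i) = c" and c: "c ^ N = 1"
  shows "B = c \<cdot>\<^sub>m 1\<^sub>m n"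
proof -
  have c0: "c \<noteq> 0" using c N(2) by (auto simp: power_0_left)
  define S where "S = mat n n (\<lambda>(i, j). \<Sum>k<N. (B ^\<^sub>m k) $$ (i, j) / c ^ k)"
  define D where "D = B - c \<cdot>\<^sub>m 1\<^sub>m n"
  have P: "B ^\<^sub>m k \<in> carrier_mat n n" for k using B by simp
  have D: "D \<in> carrier_mat n n" unfolding D_def by (intro minus_carrier_mat) simp
  have S: "S \<in> carrier_mat n n" by (simp add: S_def)
  have "upper_triangular S"
  proof (rule upper_triangularI)
    fix i j assume ij: "j < i" "i < dim_row S"
    have "(B ^\<^sub>m k) $$ (i, j) = 0" for k
      using upper_triangularD[of "B ^\<^sub>m k" j i] upper_triangular_pow[OF B, of k] P[of k] ij S B(1) by simp
    thus "S $$ (i, j) = 0" using ij S by (simp add: S_def)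
  qed
  moreover have "S $$ (j, j) \<noteq> 0" if "j < n" for j
    using that upper_triangular_pow[OF B] N(2) c0 by (simp add: S_def diag)
  moreover have "D * S = 0\<^sub>m n n"
  proof (rule eq_matI)
    fix i j assume "i < dim_row (0\<^sub>m n n :: complex mat)" "j < dim_col (0\<^sub>m n n :: complex mat)"
    hence ij: "i < n" "j < n" by auto
    have DP: "(\<Sum>l<n. D $$ (i, l) * (B ^\<^sub>m k) $$ (l, j)) =
        (B ^\<^sub>m Suc k) $$ (i, j) - c * (B ^\<^sub>m k) $$ (i, j)" for k
    proof -
      have "(\<Sum>l<n. D $$ (i, l) * (B ^\<^sub>m k) $$ (l, j)) = (D * B ^\<^sub>m k) $$ (i, j)"
        using D P ij by (subst mat_mult_entry[of _ n n _ n]) auto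
      also have "D * B ^\<^sub>m k = B * B ^\<^sub>m k - c \<cdot>\<^sub>m B ^\<^sub>m k"
        unfolding D_def using B P[of k] by (subst minus_mult_distrib_mat[of _ n n _ _ n]) (auto simp: left_mult_one_mat[OF P])
      also have "B * B ^\<^sub>m k = B ^\<^sub>m Suc k"
        by (induction k) (use B P in \<open>auto simp flip: assoc_mult_mat[OF B(1) P B(1)]\<close>)
      finally show ?thesis using carrier_matD[OF P[of k]] carrier_matD[OF P[of "Suc k"]] ij by simp
    qed
    have "(D * S) $$ (i, j) = (\<Sum>l<n. \<Sum>k<N. D $$ (i, l) * (B ^\<^sub>m k) $$ (l, j) / c ^ k)"
      using D S ij by (subst mat_mult_entry[of _ n n _ n]) (auto simp: S_def sum_distrib_left)
    also have "\<dots> = (\<Sum>k<N. (\<Sum>l<n. D $$ (i, l) * (B ^\<^sub>m k) $$ (l, j)) / c ^ k)"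
      by (subst sum.swap) (simp add: sum_divide_distrib)
    also have "\<dots> = c * (\<Sum>k<N. (B ^\<^sub>m Suc k) $$ (i, j) / c ^ Suc k - (B ^\<^sub>m k) $$ (i, j) / c ^ k)"
      unfolding DP sum_distrib_left
      by (intro sum.cong) (use c0 in \<open>auto simp: field_simps\<close>)
    also have "\<dots> = c * ((B ^\<^sub>m N) $$ (i, j) / c ^ N - (B ^\<^sub>m 0) $$ (i, j) / c ^ 0)"
      by (subst sum_lessThan_telescope) (rule refl)
    also have "\<dots> = 0" using B by (simp add: N c)
    finally show "(D * S) $$ (i, j) = 0\<^sub>m n n $$ (i, j)" using ij by simp
  qed (use D S in auto)
  ultimately have "D = 0\<^sub>m n n" by (intro mult_upper_triangular_eq_0[OF D S]) auto
  hence "D $$ (i, j) = 0" if "i < n" "j < n" for i j using that by simp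
  thus ?thesis using B by (intro eq_matI) (auto simp: D_def)
qed

text \<open>
  After triangularisation the diagonal consists of roots of unity, whose inverses are their conjugates;
  this gives the first part, as \<open>A\<^sup>N\<^sup>-\<^sup>1\<close> is the inverse of \<open>A\<close>.  In the second part the diagonal entries
  must all coincide, and a triangular matrix of finite order with constant diagonal is scalar.
\<close>
lemma finite_order_mat:
  fixes A :: "complex mat"
  assumes A: "A \<in> carrier_mat n n" and N: "A ^\<^sub>m N = 1\<^sub>m n" "N > 0"
  shows "mat_trace (A ^\<^sub>m (N - 1)) = cnj (mat_trace A)"
    and "cmod (mat_trace A) = real n \<Longrightarrow> \<exists>c. A = c \<cdot>\<^sub>m 1\<^sub>m n"
proof -
  obtain es where "char_poly A = (\<Prod>a\<leftarrow>es. [:- a, 1:])" using char_poly_factorized[OF A] by blast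
  moreover obtain B P Q where "schur_decomposition A es = (B, P, Q)" by (cases "schur_decomposition A es")
  ultimately have wit: "similar_mat_wit A B P Q" and tri: "upper_triangular B"
    using schur_decomposition[OF A] by auto
  note w = similar_mat_witD2[OF A wit]
  have pow: "A ^\<^sub>m k = P * B ^\<^sub>m k * Q" for k
    using similar_mat_wit_pow[OF wit, of k] by (auto simp: similar_mat_wit_def Let_def)
  have Bk: "B ^\<^sub>m k \<in> carrier_mat n n" for k using w by simp
  have tr: "mat_trace (A ^\<^sub>m k) = (\<Sum>i<n. (B $$ (i, i)) ^ k)" for k
  proof -
    have "mat_trace (A ^\<^sub>m k) = mat_trace (Q * (P * B ^\<^sub>m k))"
      unfolding pow using w Bk[of k] by (intro mat_trace_mult_comm[of _ n n]) auto
    also have "Q * (P * B ^\<^sub>m k) = B ^\<^sub>m k"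
      using Bk[of k] by (subst assoc_mult_mat[OF w(7,6) Bk, symmetric]) (simp add: w(2) left_mult_one_mat[OF Bk])
    also have "mat_trace (B ^\<^sub>m k) = (\<Sum>i<n. (B $$ (i, i)) ^ k)"
      using upper_triangular_pow[OF w(5) tri, of k] Bk[of k] w(5) by (simp add: mat_trace_def)
    finally show ?thesis .
  qed
  have BN: "B ^\<^sub>m N = 1\<^sub>m n"
  proof -
    have "B ^\<^sub>m N = Q * A ^\<^sub>m N * P"
      using similar_mat_wit_pow[OF similar_mat_wit_sym[OF wit], of N] by (auto simp: similar_mat_wit_def Let_def)
    thus ?thesis using w(2,6,7) unfolding N by simp
  qed
  have root: "(B $$ (i, i)) ^ N = 1" if "i < n" for i
    using upper_triangular_pow[OF w(5) tri, of N] that by (simp add: BN)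
  have unit: "cmod (B $$ (i, i)) = 1" if "i < n" for i
    using root[OF that] N(2) by (metis norm_ge_zero norm_one norm_power power_eq_1_iff less_irrefl)
  have inv: "(B $$ (i, i)) ^ (N - 1) = cnj (B $$ (i, i))" if "i < n" for i
  proof -
    let ?b = "B $$ (i, i)"
    have "?b * ?b ^ (N - 1) = 1" using root[OF that] N(2) by (metis power_eq_if less_irrefl)
    moreover have "?b * cnj ?b = 1" using unit[OF that] by (simp add: complex_norm_square[symmetric])
    ultimately show ?thesis by (metis mult_cancel_left mult_zero_left zero_neq_one)
  qed
  have A1: "mat_trace A = (\<Sum>i<n. B $$ (i, i))" using tr[of 1] A by simp
  show "mat_trace (A ^\<^sub>m (N - 1)) = cnj (mat_trace A)"
    unfolding tr A1 cnj_sum by (intro sum.cong) (auto simp: inv simp del: One_nat_def)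
  assume max: "cmod (mat_trace A) = real n"
  define c where "c = mat_trace A / of_nat n"
  have diag: "B $$ (i, i) = c" if "i < n" for i
    using unimodular_sum_max[OF unit max[unfolded A1] that] by (simp add: c_def A1)
  show "\<exists>c. A = c \<cdot>\<^sub>m 1\<^sub>m n"
  proof (cases "n = 0")
    case True
    thus ?thesis using A by (intro exI[of _ 0] eq_matI) auto
  next
    case False
    hence "c ^ N = 1" using root[of 0] diag[of 0] by simp
    hence B: "B = c \<cdot>\<^sub>m 1\<^sub>m n"
      by (intro finite_order_upper_triangular_scalar[OF w(5) tri BN N(2)]) (auto simp: diag)
    have "A = P * B * Q" by (rule w(3))
    also have "\<dots> = c \<cdot>\<^sub>m (P * Q)" unfolding B using w(6,7)
      by (metis mult_smult_assoc_mat mult_smult_distrib one_carrier_mat right_mult_one_mat)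
    finally show ?thesis by (auto simp: w(1))
  qed
qed

section \<open>Orthogonality relations\<close>

locale finite_group = group G for G (structure) +
  assumes finite_carrier: "finite (carrier G)"
begin

lemma order_pos: "order G > 0"
  using finite_carrier by (rule order_gt_0_iff_finite[THEN iffD2])

lemma sum_mult_left: "y \<in> carrier G \<Longrightarrow> (\<Sum>x\<in>carrier G. f (y \<otimes> x)) = (\<Sum>x\<in>carrier G. f x)"
  by (rule sum.reindex_bij_witness[where i = "\<lambda>x. inv y \<otimes> x" and j = "\<lambda>x. y \<otimes> x"])
     (auto simp: m_assoc[symmetric])

lemma sum_mult_right: "y \<in> carrier G \<Longrightarrow> (\<Sum>x\<in>carrier G. f (x \<otimes> y)) = (\<Sum>x\<in>carrier G. f x)"
  by (rule sum.reindex_bij_witness[where i = "\<lambda>x. x \<otimes> inv y" and j = "\<lambda>x. x \<otimes> y"])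
     (auto simp: m_assoc)

lemma sum_conjugate:
  assumes "y \<in> carrier G"
  shows "(\<Sum>x\<in>carrier G. f (y \<otimes> x \<otimes> inv y)) = (\<Sum>x\<in>carrier G. f x)"
  using sum_mult_left[OF assms, of "\<lambda>x. f (x \<otimes> inv y)"] sum_mult_right[of "inv y" f] assms by simp

context
  fixes n :: nat and \<rho> :: "'a \<Rightarrow> complex mat"
  assumes irr: "irreducible_rep G n \<rho>"
begin

lemmas rep = irreducible_repD[OF is_group irr]

lemma rep_mult_entry:
  assumes "x \<in> carrier G" "y \<in> carrier G" "i < n" "j < n"
  shows "\<rho> (x \<otimes> y) $$ (i, j) = (\<Sum>k<n. \<rho> x $$ (i, k) * \<rho> y $$ (k, j))"
  using assms rep(2) by (simp add: rep(3) mat_mult_entry[of _ n n _ n])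

lemma character_eq_sum: "x \<in> carrier G \<Longrightarrow> character G \<rho> x = (\<Sum>i<n. \<rho> x $$ (i, i))"
  using rep(2)[of x] by (simp add: character_def mat_trace_def)

lemma character_one: "character G \<rho> \<one> = of_nat n"
  by (simp add: character_def rep(4) mat_trace_def)

lemma rep_pow: "x \<in> carrier G \<Longrightarrow> \<rho> (x [^] k) = \<rho> x ^\<^sub>m k"
  using carrier_matD[OF rep(2)[of x]] by (induction k) (auto simp: rep)

lemma rep_finite_order:
  assumes "x \<in> carrier G"
  shows "\<rho> x ^\<^sub>m order G = 1\<^sub>m n" and "\<rho> (inv x) = \<rho> x ^\<^sub>m (order G - 1)"
proof -
  have "x [^] order G = \<one>" using assms by (rule pow_order_eq_1)
  thus "\<rho> x ^\<^sub>m order G = 1\<^sub>m n" using rep_pow[OF assms, of "order G"] rep(4) by simp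
  have "x [^] (order G - 1) \<otimes> x = \<one>"
    using \<open>x [^] order G = \<one>\<close> order_pos assms nat_pow_Suc[of x "order G - 1"] by simp
  hence "inv x = x [^] (order G - 1)" using assms by (intro inv_equality) auto
  thus "\<rho> (inv x) = \<rho> x ^\<^sub>m (order G - 1)" using rep_pow[OF assms] by simp
qed

lemma character_inv: "x \<in> carrier G \<Longrightarrow> character G \<rho> (inv x) = cnj (character G \<rho> x)"
  using finite_order_mat(1)[OF rep(2) rep_finite_order(1) order_pos, of x] rep_finite_order(2)
  by (simp add: character_def)

lemma scalar_if_cmod_character_max:
  "x \<in> carrier G \<Longrightarrow> cmod (character G \<rho> x) = real n \<Longrightarrow> \<exists>c. \<rho> x = c \<cdot>\<^sub>m 1\<^sub>m n"
  using finite_order_mat(2)[OF rep(2) rep_finite_order(1) order_pos, of x]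
  by (simp add: character_def)

lemma faithful_central_if_cmod_character_max:
  assumes inj: "inj_on \<rho> (carrier G)" and x: "x \<in> carrier G" "cmod (character G \<rho> x) = real n"
  shows "x \<in> center G"
proof -
  obtain c where c: "\<rho> x = c \<cdot>\<^sub>m 1\<^sub>m n" using scalar_if_cmod_character_max[OF x] by blast
  have "x \<otimes> y = y \<otimes> x" if y: "y \<in> carrier G" for y
  proof (rule inj_onD[OF inj])
    have "\<rho> (x \<otimes> y) = c \<cdot>\<^sub>m \<rho> y" "\<rho> (y \<otimes> x) = c \<cdot>\<^sub>m \<rho> y"
      using x y mult_smult_assoc_mat[OF one_carrier_mat rep(2)[OF y]]
        mult_smult_distrib[OF rep(2)[OF y] one_carrier_mat] rep(2)[OF y]
      by (simp_all add: rep(3) c)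
    thus "\<rho> (x \<otimes> y) = \<rho> (y \<otimes> x)" by simp
  qed (use x y in auto)
  thus ?thesis using x by (simp add: center_def)
qed

end

text \<open>
  \<open>B\<close> is the average \<open>\<Sum>\<^sub>x \<rho>(x) E \<sigma>(x\<inverse>)\<close> for the matrix unit \<open>E\<close> at position \<open>(k, l)\<close>, written out in
  entries.
\<close>
lemma averaged_intertwiner:
  assumes \<rho>: "irreducible_rep G n \<rho>" and \<sigma>: "irreducible_rep G m \<sigma>" and kl: "k < n" "l < m"
    and y: "y \<in> carrier G"
  defines "B \<equiv> mat n m (\<lambda>(i, j). \<Sum>x\<in>carrier G. \<rho> x $$ (i, k) * \<sigma> (inv x) $$ (l, j))"
  shows "\<rho> y * B = B * \<sigma> y"
proof (rule eq_matI)
  note r = rep(2)[OF \<rho>] and s = rep(2)[OF \<sigma>]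
  have B: "B \<in> carrier_mat n m" by (simp add: B_def)
  show "dim_row (\<rho> y * B) = dim_row (B * \<sigma> y)" "dim_col (\<rho> y * B) = dim_col (B * \<sigma> y)"
    using r[OF y] s[OF y] B by auto
  fix i j assume "i < dim_row (B * \<sigma> y)" "j < dim_col (B * \<sigma> y)"
  hence ij: "i < n" "j < m" using B s[OF y] by auto
  have "(\<rho> y * B) $$ (i, j) =
      (\<Sum>p<n. \<Sum>x\<in>carrier G. \<rho> y $$ (i, p) * \<rho> x $$ (p, k) * \<sigma> (inv x) $$ (l, j))"
    using ij r[OF y] B
    by (subst mat_mult_entry[of _ n n _ m]) (auto simp: B_def sum_distrib_left mult.assoc)
  also have "\<dots> = (\<Sum>x\<in>carrier G. \<rho> (y \<otimes> x) $$ (i, k) * \<sigma> (inv x) $$ (l, j))"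
    using ij kl y
    by (subst sum.swap) (simp add: rep_mult_entry[OF \<rho>] sum_distrib_right)
  also have "\<dots> = (\<Sum>x\<in>carrier G. \<rho> (y \<otimes> x) $$ (i, k) * \<sigma> (inv (y \<otimes> x) \<otimes> y) $$ (l, j))"
    using y by (intro sum.cong) (auto simp: inv_mult_group m_assoc)
  also have "\<dots> = (\<Sum>x\<in>carrier G. \<rho> x $$ (i, k) * \<sigma> (inv x \<otimes> y) $$ (l, j))"
    using y by (rule sum_mult_left)
  also have "\<dots> = (\<Sum>q<m. \<Sum>x\<in>carrier G. \<rho> x $$ (i, k) * \<sigma> (inv x) $$ (l, q) * \<sigma> y $$ (q, j))"
    using ij kl y
    by (subst sum.swap) (simp add: rep_mult_entry[OF \<sigma>] sum_distrib_left mult.assoc)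
  also have "\<dots> = (B * \<sigma> y) $$ (i, j)"
    using ij s[OF y] B
    by (subst mat_mult_entry[of _ n m _ m]) (auto simp: B_def sum_distrib_right)
  finally show "(\<rho> y * B) $$ (i, j) = (B * \<sigma> y) $$ (i, j)" .
qed

lemma matrix_coefficients_orthogonal:
  assumes \<rho>: "irreducible_rep G n \<rho>" and \<sigma>: "irreducible_rep G m \<sigma>"
    and ne: "character G \<rho> \<noteq> character G \<sigma>" and ijkl: "i < n" "k < n" "l < m" "j < m"
  shows "(\<Sum>x\<in>carrier G. \<rho> x $$ (i, k) * \<sigma> (inv x) $$ (l, j)) = 0"
proof -
  let ?B = "mat n m (\<lambda>(i, j). \<Sum>x\<in>carrier G. \<rho> x $$ (i, k) * \<sigma> (inv x) $$ (l, j))"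
  have "?B = 0\<^sub>m n m"
    using schur_intertwiner[OF is_group \<rho> \<sigma>, of ?B] averaged_intertwiner[OF \<rho> \<sigma> ijkl(2,3)] ne by fastforce
  hence "?B $$ (i, j) = 0" using ijkl by simp
  thus ?thesis using ijkl by simp
qed

text \<open>
  By Schur's lemma the average is scalar, and its trace is that of \<open>\<Sum>\<^sub>x E \<rho>(x\<inverse>)\<rho>(x)\<close>.
\<close>
lemma matrix_coefficients_self:
  assumes \<rho>: "irreducible_rep G n \<rho>" and ijkl: "i < n" "k < n" "l < n" "j < n"
  shows "(\<Sum>x\<in>carrier G. \<rho> x $$ (i, k) * \<rho> (inv x) $$ (l, j)) =
    (if i = j \<and> k = l then of_nat (order G) / of_nat n else 0)"
proof -
  let ?B = "mat n n (\<lambda>(i, j). \<Sum>x\<in>carrier G. \<rho> x $$ (i, k) * \<rho> (inv x) $$ (l, j))"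
  have eq: "?B = (mat_trace ?B / of_nat n) \<cdot>\<^sub>m 1\<^sub>m n"
    by (rule schur_endomorphism_scalar[OF is_group \<rho>])
       (use averaged_intertwiner[OF \<rho> \<rho> ijkl(2,3)] in auto)
  have "mat_trace ?B = (\<Sum>x\<in>carrier G. \<Sum>i<n. \<rho> (inv x) $$ (l, i) * \<rho> x $$ (i, k))"
    by (simp add: mat_trace_def mult.commute) (rule sum.swap)
  also have "\<dots> = (\<Sum>x\<in>carrier G. \<rho> (inv x \<otimes> x) $$ (l, k))"
    using ijkl by (intro sum.cong refl rep_mult_entry[OF \<rho>, symmetric]) auto
  also have "\<dots> = (if k = l then of_nat (order G) else 0)"
    using ijkl by (simp add: rep(4)[OF \<rho>] order_def)
  finally have tr: "mat_trace ?B = (if k = l then of_nat (order G) else 0)" .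
  have "(\<Sum>x\<in>carrier G. \<rho> x $$ (i, k) * \<rho> (inv x) $$ (l, j)) = ?B $$ (i, j)"
    using ijkl by simp
  also have "\<dots> = ((mat_trace ?B / of_nat n) \<cdot>\<^sub>m 1\<^sub>m n) $$ (i, j)" using eq by (rule arg_cong)
  also have "\<dots> = (if i = j \<and> k = l then of_nat (order G) / of_nat n else 0)"
    unfolding tr using ijkl by simp
  finally show ?thesis .
qed

lemma irreducible_characterE:
  assumes "\<chi> \<in> irreducible_characters G"
  obtains n \<rho> where "irreducible_rep G n \<rho>" "\<chi> = character G \<rho>"
  using assms by (auto simp: irreducible_characters_def)

lemma irreducible_character_inv:
  "\<chi> \<in> irreducible_characters G \<Longrightarrow> x \<in> carrier G \<Longrightarrow> \<chi> (inv x) = cnj (\<chi> x)"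
  by (elim irreducible_characterE) (auto simp: character_inv)

lemma irreducible_character_commute:
  assumes "\<chi> \<in> irreducible_characters G" "x \<in> carrier G" "y \<in> carrier G"
  shows "\<chi> (x \<otimes> y) = \<chi> (y \<otimes> x)"
proof -
  obtain n \<rho> where \<rho>: "irreducible_rep G n \<rho>" "\<chi> = character G \<rho>"
    using assms(1) by (rule irreducible_characterE)
  thus ?thesis using assms(2,3) mat_trace_mult_comm[OF rep(2)[OF \<rho>(1)] rep(2)[OF \<rho>(1)], of x y]
    by (simp add: character_def rep(3)[OF \<rho>(1)])
qed

lemma irreducible_character_orthogonality:
  assumes \<chi>: "\<chi> \<in> irreducible_characters G" and \<psi>: "\<psi> \<in> irreducible_characters G"
  shows "(\<Sum>x\<in>carrier G. \<chi> x * \<psi> (inv x)) = (if \<chi> = \<psi> then of_nat (order G) else 0)"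
proof -
  obtain n \<rho> where \<rho>: "irreducible_rep G n \<rho>" "\<chi> = character G \<rho>"
    using \<chi> by (rule irreducible_characterE)
  obtain m \<sigma> where \<sigma>: "irreducible_rep G m \<sigma>" "\<psi> = character G \<sigma>"
    using \<psi> by (rule irreducible_characterE)
  have expand: "(\<Sum>x\<in>carrier G. \<chi> x * character G \<tau> (inv x)) =
      (\<Sum>i<n. \<Sum>j<p. \<Sum>x\<in>carrier G. \<rho> x $$ (i, i) * \<tau> (inv x) $$ (j, j))"
    if \<tau>: "irreducible_rep G p \<tau>" for p \<tau>
  proof -
    have "(\<Sum>x\<in>carrier G. \<chi> x * character G \<tau> (inv x)) =
        (\<Sum>x\<in>carrier G. \<Sum>i<n. \<Sum>j<p. \<rho> x $$ (i, i) * \<tau> (inv x) $$ (j, j))"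
      by (intro sum.cong)
         (auto simp: \<rho>(2) character_eq_sum[OF \<rho>(1)] character_eq_sum[OF \<tau>] sum_product)
    also have "\<dots> = (\<Sum>i<n. \<Sum>j<p. \<Sum>x\<in>carrier G. \<rho> x $$ (i, i) * \<tau> (inv x) $$ (j, j))"
      by (subst sum.swap, subst (2) sum.swap) (rule refl)
    finally show ?thesis .
  qed
  show ?thesis
  proof (cases "\<chi> = \<psi>")
    case True
    have "(\<Sum>x\<in>carrier G. \<chi> x * \<chi> (inv x)) =
        (\<Sum>i<n. \<Sum>j<n. if i = j then of_nat (order G) / of_nat n else 0)"
      unfolding \<rho>(2) expand[OF \<rho>(1), unfolded \<rho>(2)]
      by (intro sum.cong) (auto simp: matrix_coefficients_self[OF \<rho>(1)])
    also have "\<dots> = of_nat (order G)" using rep(1)[OF \<rho>(1)] by simp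
    finally show ?thesis using True by simp
  next
    case False
    hence "(\<Sum>x\<in>carrier G. \<chi> x * \<psi> (inv x)) = 0"
      unfolding \<sigma>(2) expand[OF \<sigma>(1)] unfolding \<rho>(2)
      by (intro sum.neutral ballI matrix_coefficients_orthogonal[OF \<rho>(1) \<sigma>(1)]) auto
    thus ?thesis using False by simp
  qed
qed

text \<open>
  The average of \<open>\<rho>(a)\<rho>(b)\<rho>(a)\<inverse>\<close> over \<open>a\<close> is the scalar with the same trace as \<open>\<rho>(b)\<close>.  This functional
  equation of irreducible characters drives both the count of commutators and the averaging over
  level sets.
\<close>
lemma irreducible_character_average:
  assumes \<chi>: "\<chi> \<in> irreducible_characters G" and b: "b \<in> carrier G" and y: "y \<in> carrier G"
  shows "(\<Sum>a\<in>carrier G. \<chi> (a \<otimes> b \<otimes> inv a \<otimes> y)) = of_nat (order G) * \<chi> b * \<chi> y / \<chi> \<one>"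
proof -
  obtain n \<rho> where \<rho>: "irreducible_rep G n \<rho>" "\<chi> = character G \<rho>"
    using \<chi> by (rule irreducible_characterE)
  have "(\<Sum>a\<in>carrier G. \<chi> (a \<otimes> b \<otimes> inv a \<otimes> y)) =
      (\<Sum>a\<in>carrier G. \<Sum>i<n. \<Sum>j<n. \<Sum>l<n. \<Sum>k<n.
         (\<rho> b $$ (k, l) * \<rho> y $$ (j, i)) * (\<rho> a $$ (i, k) * \<rho> (inv a) $$ (l, j)))"
    using b y by (intro sum.cong)
      (auto simp: \<rho>(2) character_eq_sum[OF \<rho>(1)] rep_mult_entry[OF \<rho>(1)] sum_distrib_right
        sum_distrib_left mult_ac)
  also have "\<dots> = (\<Sum>i<n. \<Sum>j<n. \<Sum>l<n. \<Sum>k<n. (\<rho> b $$ (k, l) * \<rho> y $$ (j, i)) *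
      (\<Sum>a\<in>carrier G. \<rho> a $$ (i, k) * \<rho> (inv a) $$ (l, j)))"
    by (subst sum.swap, intro sum.cong refl, subst sum.swap, intro sum.cong refl,
        subst sum.swap, intro sum.cong refl, subst sum.swap) (simp add: sum_distrib_left)
  also have "\<dots> = (\<Sum>i<n. \<Sum>j<n. if j = i then
      (\<Sum>l<n. \<rho> b $$ (l, l) * \<rho> y $$ (i, i) * (of_nat (order G) / of_nat n)) else 0)"
  proof (intro sum.cong refl)
    fix i j assume ij: "i \<in> {..<n}" "j \<in> {..<n}"
    have "(\<Sum>k<n. (\<rho> b $$ (k, l) * \<rho> y $$ (j, i)) *
          (\<Sum>a\<in>carrier G. \<rho> a $$ (i, k) * \<rho> (inv a) $$ (l, j))) =
        (if j = i then \<rho> b $$ (l, l) * \<rho> y $$ (i, i) * (of_nat (order G) / of_nat n) else 0)"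
      if l: "l < n" for l
    proof -
      have "(\<Sum>k<n. (\<rho> b $$ (k, l) * \<rho> y $$ (j, i)) *
          (\<Sum>a\<in>carrier G. \<rho> a $$ (i, k) * \<rho> (inv a) $$ (l, j))) =
        (\<Sum>k<n. if k = l then if j = i then
          \<rho> b $$ (l, l) * \<rho> y $$ (i, i) * (of_nat (order G) / of_nat n) else 0 else 0)"
        using ij l by (intro sum.cong refl) (auto simp: matrix_coefficients_self[OF \<rho>(1)])
      also have "\<dots> = (if j = i then \<rho> b $$ (l, l) * \<rho> y $$ (i, i) * (of_nat (order G) / of_nat n) else 0)"
        using l by (simp only: sum.delta finite_lessThan lessThan_iff if_True)
      finally show ?thesis .
    qed
    thus "(\<Sum>l<n. \<Sum>k<n. (\<rho> b $$ (k, l) * \<rho> y $$ (j, i)) *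
          (\<Sum>a\<in>carrier G. \<rho> a $$ (i, k) * \<rho> (inv a) $$ (l, j))) =
        (if j = i then (\<Sum>l<n. \<rho> b $$ (l, l) * \<rho> y $$ (i, i) * (of_nat (order G) / of_nat n)) else 0)"
      by simp
  qed
  also have "\<dots> = (\<Sum>i<n. \<Sum>l<n. \<rho> b $$ (l, l) * \<rho> y $$ (i, i) * (of_nat (order G) / of_nat n))"
    by (rule sum.cong[OF refl]) (simp only: sum.delta finite_lessThan lessThan_iff if_True)
  also have "\<dots> = (\<Sum>l<n. \<rho> b $$ (l, l)) * (\<Sum>i<n. \<rho> y $$ (i, i)) * (of_nat (order G) / of_nat n)"
    by (simp only: sum_distrib_right[symmetric] sum_distrib_left[symmetric] mult.assoc)
  finally show ?thesis
    using b y by (simp add: \<rho>(2) character_eq_sum[OF \<rho>(1)] character_one[OF \<rho>(1)])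
qed

text \<open>
  A class function gives a central element of the group algebra, which acts on an irreducible
  representation by a scalar; the orthogonality says that this scalar has trace zero.
\<close>
lemma class_function_annihilates_rep:
  assumes \<rho>: "irreducible_rep G n \<rho>"
    and conj: "\<And>x y. x \<in> carrier G \<Longrightarrow> y \<in> carrier G \<Longrightarrow> f (y \<otimes> x \<otimes> inv y) = f x"
    and orth: "(\<Sum>x\<in>carrier G. f x * character G \<rho> (inv x)) = 0" and ij: "i < n" "j < n"
  shows "(\<Sum>x\<in>carrier G. f x * \<rho> (inv x) $$ (i, j)) = 0"
proof -
  define M where "M = mat n n (\<lambda>(i, j). \<Sum>x\<in>carrier G. f x * \<rho> (inv x) $$ (i, j))"
  have M: "M \<in> carrier_mat n n" by (simp add: M_def)
  have comm: "\<rho> y * M = M * \<rho> y" if y: "y \<in> carrier G" for y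
  proof (rule eq_matI)
    fix i j assume "i < dim_row (M * \<rho> y)" "j < dim_col (M * \<rho> y)"
    hence ij: "i < n" "j < n" using M rep(2)[OF \<rho> y] by auto
    have "(\<rho> y * M) $$ (i, j) = (\<Sum>p<n. \<Sum>x\<in>carrier G. f x * (\<rho> y $$ (i, p) * \<rho> (inv x) $$ (p, j)))"
      using ij rep(2)[OF \<rho> y] M
      by (subst mat_mult_entry[of _ n n _ n]) (auto simp: M_def sum_distrib_left mult_ac)
    also have "\<dots> = (\<Sum>x\<in>carrier G. f x * \<rho> (y \<otimes> inv x) $$ (i, j))"
      using ij y by (subst sum.swap) (simp add: rep_mult_entry[OF \<rho>] sum_distrib_left)
    also have "\<dots> = (\<Sum>x\<in>carrier G. f (y \<otimes> x \<otimes> inv y) * \<rho> (inv (y \<otimes> x \<otimes> inv y) \<otimes> y) $$ (i, j))"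
    proof (intro sum.cong refl)
      fix x assume x: "x \<in> carrier G"
      have "inv (y \<otimes> x \<otimes> inv y) \<otimes> y = y \<otimes> inv x"
        using x y by (simp add: inv_mult_group m_assoc)
      thus "f x * \<rho> (y \<otimes> inv x) $$ (i, j) =
          f (y \<otimes> x \<otimes> inv y) * \<rho> (inv (y \<otimes> x \<otimes> inv y) \<otimes> y) $$ (i, j)"
        using conj[OF x y] by simp
    qed
    also have "\<dots> = (\<Sum>x\<in>carrier G. f x * \<rho> (inv x \<otimes> y) $$ (i, j))"
      using y by (rule sum_conjugate)
    also have "\<dots> = (\<Sum>p<n. \<Sum>x\<in>carrier G. f x * \<rho> (inv x) $$ (i, p) * \<rho> y $$ (p, j))"
      using ij y by (subst sum.swap) (simp add: rep_mult_entry[OF \<rho>] sum_distrib_left mult.assoc)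
    also have "\<dots> = (M * \<rho> y) $$ (i, j)"
      using ij rep(2)[OF \<rho> y] M
      by (subst mat_mult_entry[of _ n n _ n]) (auto simp: M_def sum_distrib_right)
    finally show "(\<rho> y * M) $$ (i, j) = (M * \<rho> y) $$ (i, j)" .
  qed (use M rep(2)[OF \<rho> y] in auto)
  have "mat_trace M = (\<Sum>x\<in>carrier G. f x * character G \<rho> (inv x))"
    by (simp add: mat_trace_def M_def character_eq_sum[OF \<rho>] sum_distrib_left) (rule sum.swap)
  hence "M = 0 \<cdot>\<^sub>m 1\<^sub>m n"
    using schur_endomorphism_scalar[OF is_group \<rho> M comm] orth by simp
  hence "M $$ (i, j) = 0" using ij by simp
  thus ?thesis using ij by (simp add: M_def)
qed

end

section \<open>Completeness of the irreducible characters\<close>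

text \<open>
  Complex functions on the group are handled as a vector space in the sense of the locale
  \<^locale>\<open>vector_space\<close>, which supplies bases and the exchange lemma for subspaces given by spanning sets.
\<close>
definition fun_scale :: "complex \<Rightarrow> ('a \<Rightarrow> complex) \<Rightarrow> 'a \<Rightarrow> complex" where
  "fun_scale c f = (\<lambda>x. c * f x)"

interpretation funs: vector_space fun_scale
  by unfold_locales (auto simp: fun_scale_def fun_eq_iff algebra_simps)

lemma sum_fun_apply: "(\<Sum>i\<in>I. F i) x = (\<Sum>i\<in>I. F i x)" for F :: "'i \<Rightarrow> 'a \<Rightarrow> complex"
  by (induction I rule: infinite_finite_induct) auto

text \<open>
  The value outside the carrier is set to zero, so that translation is a genuine action on the functions
  supported on the carrier.
\<close>
definition (in group) left_translate :: "'a \<Rightarrow> ('a \<Rightarrow> complex) \<Rightarrow> 'a \<Rightarrow> complex" where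
  "left_translate x f = (\<lambda>y. if y \<in> carrier G then f (inv x \<otimes> y) else 0)"

context finite_group
begin

lemma left_translate_add: "left_translate x (f + g) = left_translate x f + left_translate x g"
  by (auto simp: left_translate_def fun_eq_iff)

lemma left_translate_scale: "left_translate x (fun_scale c f) = fun_scale c (left_translate x f)"
  by (auto simp: left_translate_def fun_eq_iff fun_scale_def)

lemma left_translate_zero: "left_translate x 0 = 0"
  by (auto simp: left_translate_def fun_eq_iff)

lemma left_translate_sum: "left_translate x (\<Sum>i\<in>I. F i) = (\<Sum>i\<in>I. left_translate x (F i))"
proof (induction I rule: infinite_finite_induct)
  case (insert i I)
  show ?case unfolding sum.insert[OF insert.hyps] left_translate_add insert.IH ..
qed (simp_all only: sum.infinite sum.empty left_translate_zero not_False_eq_True)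

lemma left_translate_mult:
  "x \<in> carrier G \<Longrightarrow> y \<in> carrier G \<Longrightarrow>
    left_translate (x \<otimes> y) f = left_translate x (left_translate y f)"
  by (auto simp: left_translate_def fun_eq_iff inv_mult_group m_assoc)

lemma left_translate_one: "(\<And>y. y \<notin> carrier G \<Longrightarrow> f y = 0) \<Longrightarrow> left_translate \<one> f = f"
  by (auto simp: left_translate_def fun_eq_iff)

lemma span_left_translate_invariant:
  assumes "\<And>f. f \<in> F \<Longrightarrow> left_translate x f \<in> funs.span F" and "f \<in> funs.span F"
  shows "left_translate x f \<in> funs.span F"
  using assms(2)
proof (induction rule: funs.span_induct_alt)
  case base
  show ?case unfolding left_translate_zero by (rule funs.span_zero)
next
  case (step c f g)
  show ?case unfolding left_translate_add left_translate_scale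
    by (intro funs.span_add funs.span_scale assms(1) step)
qed

text \<open>
  Take a finite set \<open>B\<close> of least cardinality that spans a nonzero invariant subspace of the given space.
  It is linearly independent, and translation in the coordinates of \<open>B\<close> is a matrix representation.  A
  nonzero invariant subspace of the coordinate space corresponds to a nonzero invariant subspace \<open>V\<close> of
  the span of \<open>B\<close>; by minimality a basis of \<open>V\<close> is as large as \<open>B\<close>, so \<open>V\<close> is the whole span.
\<close>
lemma invariant_function_space_contains_irreducible:
  assumes F: "finite F" and nz: "\<exists>f\<in>funs.span F. f \<noteq> 0"
    and supp: "\<And>f y. f \<in> funs.span F \<Longrightarrow> y \<notin> carrier G \<Longrightarrow> f y = 0"
    and inv: "\<And>x f. x \<in> carrier G \<Longrightarrow> f \<in> funs.span F \<Longrightarrow> left_translate x f \<in> funs.span F"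
  shows "\<exists>n \<rho> b. irreducible_rep G n \<rho> \<and> (\<forall>j<n. b j \<in> funs.span F \<and> b j \<noteq> 0 \<and>
    (\<forall>x\<in>carrier G. left_translate x (b j) = (\<Sum>i<n. fun_scale (\<rho> x $$ (i, j)) (b i))))"
proof -
  define P where "P = (\<lambda>B. finite B \<and> B \<subseteq> funs.span F \<and> (\<exists>f\<in>funs.span B. f \<noteq> 0) \<and>
    (\<forall>x\<in>carrier G. \<forall>f\<in>funs.span B. left_translate x f \<in> funs.span B))"
  have "P F" using F nz inv by (auto simp: P_def funs.span_base)
  then obtain B where PB: "P B" and min: "\<And>B'. P B' \<Longrightarrow> card B \<le> card B'"
    using ex_has_least_nat[of P F card] by blast
  have B: "finite B" "B \<subseteq> funs.span F" "\<exists>f\<in>funs.span B. f \<noteq> 0"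
    and Binv: "\<And>x f. x \<in> carrier G \<Longrightarrow> f \<in> funs.span B \<Longrightarrow> left_translate x f \<in> funs.span B"
    using PB by (auto simp: P_def)
  have sub: "funs.span B \<subseteq> funs.span F"
    using B(2) by (metis funs.span_minimal funs.subspace_span)
  have indep: "funs.independent B"
  proof
    assume "funs.dependent B"
    then obtain a where a: "a \<in> B" "a \<in> funs.span (B - {a})" by (auto simp: funs.dependent_def)
    have eq: "funs.span (B - {a}) = funs.span B"
      using funs.span_redundant[OF a(2)] a(1) by (simp add: insert_absorb)
    have "P (B - {a})" using PB unfolding P_def eq by auto
    from min[OF this] show False using a(1) B(1) by (meson card_Diff1_less not_le)
  qed
  define m where "m = card B"
  obtain b where b: "bij_betw b {..<m} B"
    using ex_bij_betw_nat_finite[OF B(1)] by (auto simp: m_def atLeast0LessThan)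
  have bB: "b i \<in> B" if "i < m" for i using b that by (auto simp: bij_betw_def)
  define comb where "comb = (\<lambda>c. \<Sum>i<m. fun_scale (c i) (b i))"
  have comb_sum: "comb c = (\<Sum>i<m. fun_scale (c i) (b i))" for c by (simp only: comb_def)
  have comb_span: "comb c \<in> funs.span B" for c
    unfolding comb_def by (intro funs.span_sum funs.span_scale funs.span_base) (auto simp: bB)
  have ex_comb: "\<exists>c. f = comb c" if "f \<in> funs.span B" for f
  proof -
    have "f = (\<Sum>v\<in>B. fun_scale (funs.representation B f v) v)"
      using funs.sum_representation_eq[OF indep that B(1)] by simp
    also have "\<dots> = comb (\<lambda>i. funs.representation B f (b i))"
      unfolding comb_def by (rule sum.reindex_bij_betw[OF b, symmetric])
    finally show ?thesis by blast
  qed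
  \<comment> \<open>Coordinates with respect to \<open>b\<close> are unique.\<close>
  have comb_0: "c i = 0" if "comb c = 0" "i < m" for c i
  proof -
    let ?u = "\<lambda>v. c (inv_into {..<m} b v)"
    have inj: "inj_on b {..<m}" using b by (simp add: bij_betw_def)
    have "(\<Sum>v\<in>B. fun_scale (?u v) v) = (\<Sum>i<m. fun_scale (?u (b i)) (b i))"
      using sum.reindex_bij_betw[OF b, of "\<lambda>v. fun_scale (?u v) v"] by simp
    also have "\<dots> = comb c" unfolding comb_def using inj by (intro sum.cong) auto
    finally have "(\<Sum>v\<in>B. fun_scale (?u v) v) = 0" using that by simp
    from funs.independentD[OF indep B(1) _ this, of "b i"] show ?thesis
      using that(2) bB[OF that(2)] inj by simp
  qed
  have comb_diff: "comb (\<lambda>i. c i - d i) = comb c - comb d" for c d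
    by (simp add: comb_def funs.scale_left_diff_distrib sum_subtractf)
  have comb_eq: "c i = d i" if "comb c = comb d" "i < m" for c d i
    using comb_0[of "\<lambda>i. c i - d i" i] that by (simp add: comb_diff)
  have comb_add: "comb (\<lambda>i. c i + d i) = comb c + comb d" for c d
    by (simp add: comb_def funs.scale_left_distrib sum.distrib)
  have comb_scale: "comb (\<lambda>i. a * c i) = fun_scale a (comb c)" for a c
    by (simp add: comb_def funs.scale_sum_right)
  have comb_cong: "comb c = comb d" if "\<And>i. i < m \<Longrightarrow> c i = d i" for c d
    unfolding comb_def using that by (intro sum.cong) auto
  \<comment> \<open>Column \<open>j\<close> holds the coordinates of the translate of \<open>b j\<close>.\<close>
  define \<rho> where "\<rho> = (\<lambda>x. mat m m (\<lambda>(i, j). (SOME c. left_translate x (b j) = comb c) i))"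
  have \<rho>: "\<rho> x \<in> carrier_mat m m" for x by (simp add: \<rho>_def)
  have Lb: "left_translate x (b j) = comb (\<lambda>i. \<rho> x $$ (i, j))" if "x \<in> carrier G" "j < m" for x j
  proof -
    have "\<exists>c. left_translate x (b j) = comb c"
      using that bB by (intro ex_comb Binv funs.span_base) auto
    hence "left_translate x (b j) = comb (SOME c. left_translate x (b j) = comb c)"
      by (rule someI_ex)
    also have "\<dots> = comb (\<lambda>i. \<rho> x $$ (i, j))" using that by (intro comb_cong) (simp add: \<rho>_def)
    finally show ?thesis .
  qed
  have Lcomb: "left_translate x (comb c) = comb (\<lambda>i. \<Sum>j<m. \<rho> x $$ (i, j) * c j)"
    if x: "x \<in> carrier G" for x c
  proof -
    have "left_translate x (comb c) = (\<Sum>j<m. fun_scale (c j) (comb (\<lambda>i. \<rho> x $$ (i, j))))"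
      unfolding comb_sum[of c] left_translate_sum left_translate_scale
      by (intro sum.cong refl) (simp add: Lb x)
    also have "\<dots> = (\<Sum>j<m. \<Sum>i<m. fun_scale (c j * \<rho> x $$ (i, j)) (b i))"
      by (simp add: comb_def funs.scale_sum_right)
    also have "\<dots> = comb (\<lambda>i. \<Sum>j<m. \<rho> x $$ (i, j) * c j)"
      by (subst sum.swap) (simp add: comb_def funs.scale_sum_left mult.commute)
    finally show ?thesis .
  qed
  have mult: "\<rho> (x \<otimes> y) = \<rho> x * \<rho> y" if xy: "x \<in> carrier G" "y \<in> carrier G" for x y
  proof (rule eq_matI)
    fix i j assume "i < dim_row (\<rho> x * \<rho> y)" "j < dim_col (\<rho> x * \<rho> y)"
    hence ij: "i < m" "j < m" using \<rho> carrier_matD[OF \<rho>] by auto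
    have "comb (\<lambda>i. \<rho> (x \<otimes> y) $$ (i, j)) = left_translate x (comb (\<lambda>i. \<rho> y $$ (i, j)))"
      using xy ij by (simp flip: Lb add: left_translate_mult)
    also have "\<dots> = comb (\<lambda>i. \<Sum>k<m. \<rho> x $$ (i, k) * \<rho> y $$ (k, j))" by (rule Lcomb[OF xy(1)])
    finally have "\<rho> (x \<otimes> y) $$ (i, j) = (\<Sum>k<m. \<rho> x $$ (i, k) * \<rho> y $$ (k, j))"
      using ij(1) by (rule comb_eq)
    thus "\<rho> (x \<otimes> y) $$ (i, j) = (\<rho> x * \<rho> y) $$ (i, j)"
      using ij by (simp add: mat_mult_entry[OF \<rho> \<rho>])
  qed (use carrier_matD[OF \<rho>] in auto)
  have one: "\<rho> \<one> = 1\<^sub>m m"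
  proof (rule eq_matI)
    fix i j assume "i < dim_row (1\<^sub>m m :: complex mat)" "j < dim_col (1\<^sub>m m :: complex mat)"
    hence ij: "i < m" "j < m" by auto
    have "comb (\<lambda>i. \<rho> \<one> $$ (i, j)) = left_translate \<one> (b j)" using ij by (simp add: Lb)
    also have "\<dots> = b j"
      using supp bB[OF ij(2)] B(2) by (intro left_translate_one) auto
    also have "\<dots> = comb (\<lambda>i. if i = j then 1 else 0)"
    proof -
      have "comb (\<lambda>i. if i = j then 1 else 0) = (\<Sum>i<m. if i = j then b i else 0)"
        unfolding comb_def by (intro sum.cong) auto
      thus ?thesis using ij by simp
    qed
    finally have "\<rho> \<one> $$ (i, j) = (if i = j then 1 else 0)" using ij(1) by (rule comb_eq)
    thus "\<rho> \<one> $$ (i, j) = 1\<^sub>m m $$ (i, j)" using ij by simp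
  qed (use carrier_matD[OF \<rho>] in auto)
  have hom: "\<rho> \<in> hom G (GL m)"
  proof (rule homI)
    fix x assume x: "x \<in> carrier G"
    have "\<rho> x * \<rho> (inv x) = 1\<^sub>m m" "\<rho> (inv x) * \<rho> x = 1\<^sub>m m"
      using x by (simp_all flip: mult add: one)
    thus "\<rho> x \<in> carrier (GL m)"
      using \<rho> by (auto simp: GL_def units_of_carrier Units_def ring_mat_simps)
  next
    fix x y assume "x \<in> carrier G" "y \<in> carrier G"
    thus "\<rho> (x \<otimes> y) = \<rho> x \<otimes>\<^bsub>GL m\<^esub> \<rho> y"
      by (simp add: mult GL_def units_of_mult ring_mat_simps)
  qed
  have m: "m > 0"
  proof (rule ccontr)
    assume "\<not> m > 0"
    hence "B = {}" using B(1) by (simp add: m_def)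
    thus False using B(3) by simp
  qed
  have "W = carrier_vec m" if W: "subspace class_ring W (module_vec TYPE(complex) m)"
    and Winv: "\<forall>x\<in>carrier G. \<forall>w\<in>W. \<rho> x *\<^sub>v w \<in> W" and Wnz: "W \<noteq> {0\<^sub>v m}" for W
  proof -
    have Wc: "W \<subseteq> carrier_vec m" and W0: "0\<^sub>v m \<in> W" and Wadd: "\<And>v w. v \<in> W \<Longrightarrow> w \<in> W \<Longrightarrow> v + w \<in> W"
      and Wsc: "\<And>c v. v \<in> W \<Longrightarrow> c \<cdot>\<^sub>v v \<in> W"
      using W by (auto simp: subspace_vec_iff)
    define V where "V = (\<lambda>w. comb (\<lambda>i. w $ i)) ` W"
    have V: "funs.subspace V"
    proof (rule funs.subspaceI)
      have "comb (\<lambda>i. 0\<^sub>v m $ i) = comb (\<lambda>i. 0)" by (rule comb_cong) simp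
      also have "\<dots> = 0" by (simp add: comb_def)
      finally show "0 \<in> V" using W0 unfolding V_def by (metis imageI)
      show "f + g \<in> V" if "f \<in> V" "g \<in> V" for f g
      proof -
        from that obtain v w where vw: "v \<in> W" "w \<in> W" "f = comb (\<lambda>i. v $ i)" "g = comb (\<lambda>i. w $ i)"
          by (auto simp: V_def)
        have "f + g = comb (\<lambda>i. (v + w) $ i)"
          using vw Wc by (auto simp flip: comb_add intro!: comb_cong)
        thus ?thesis using Wadd[OF vw(1,2)] by (auto simp: V_def)
      qed
      show "fun_scale c f \<in> V" if "f \<in> V" for c f
      proof -
        from that obtain v where v: "v \<in> W" "f = comb (\<lambda>i. v $ i)" by (auto simp: V_def)
        have "fun_scale c f = comb (\<lambda>i. (c \<cdot>\<^sub>v v) $ i)"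
          using v Wc by (auto simp flip: comb_scale intro!: comb_cong)
        thus ?thesis using Wsc[OF v(1)] by (auto simp: V_def)
      qed
    qed
    have Vinv: "left_translate x f \<in> V" if x: "x \<in> carrier G" and f: "f \<in> V" for x f
    proof -
      from f obtain w where w: "w \<in> W" "f = comb (\<lambda>i. w $ i)" by (auto simp: V_def)
      have "left_translate x f = comb (\<lambda>i. (\<rho> x *\<^sub>v w) $ i)"
        unfolding w(2) Lcomb[OF x] using w(1) Wc carrier_matD[OF \<rho>[of x]]
        by (intro comb_cong) (auto simp: scalar_prod_def atLeast0LessThan intro!: sum.cong)
      thus ?thesis using Winv x w(1) by (auto simp: V_def)
    qed
    have VB: "V \<subseteq> funs.span B" by (auto simp: V_def comb_span)
    obtain B' where B': "B' \<subseteq> V" "funs.independent B'" "V \<subseteq> funs.span B'"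
      using funs.basis_exists[of V] by metis
    have span': "funs.span B' = V" using B'(1,3) V by (rule funs.span_subspace)
    have fin': "finite B'"
      using funs.independent_span_bound[OF B(1) B'(2)] B'(1) VB by blast
    obtain w where w: "w \<in> W" "w \<noteq> 0\<^sub>v m" using W0 Wnz by blast
    have "comb (\<lambda>i. w $ i) \<noteq> 0"
    proof
      assume "comb (\<lambda>i. w $ i) = 0"
      from comb_0[OF this] have "w = 0\<^sub>v m" using w(1) Wc by (intro eq_vecI) auto
      thus False using w(2) by simp
    qed
    hence "\<exists>f\<in>V. f \<noteq> 0" using w(1) by (auto simp: V_def)
    hence "P B'" using fin' B'(1) VB sub Vinv unfolding P_def span' by blast
    from min[OF this] have card: "card B \<le> card B'" .
    have "funs.span B \<subseteq> V"
    proof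
      fix a assume a: "a \<in> funs.span B"
      show "a \<in> V"
      proof (rule ccontr)
        assume "a \<notin> V"
        hence a': "a \<notin> funs.span B'" "a \<notin> B'" using span' B'(1) by auto
        have "card (insert a B') \<le> card B"
          using funs.independent_span_bound[OF B(1) funs.independent_insertI[OF a'(1) B'(2)]] a B'(1) VB
          by blast
        thus False using card a'(2) fin' by simp
      qed
    qed
    show ?thesis
    proof (rule antisym[OF Wc subsetI])
      fix v :: "complex vec" assume v: "v \<in> carrier_vec m"
      have "comb (\<lambda>i. v $ i) \<in> V" using comb_span \<open>funs.span B \<subseteq> V\<close> by blast
      then obtain w where w: "w \<in> W" "comb (\<lambda>i. v $ i) = comb (\<lambda>i. w $ i)" by (auto simp: V_def)
      have "v = w" using comb_eq[OF w(2)] v w(1) Wc by (intro eq_vecI) auto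
      thus "v \<in> W" using w(1) by simp
    qed
  qed
  hence "irreducible_rep G m \<rho>" using hom m unfolding irreducible_rep_def by blast
  moreover have "b j \<noteq> 0" if "j < m" for j
    using bB[OF that] indep by (metis funs.dependent_zero)
  moreover have "b j \<in> funs.span F" if "j < m" for j using bB[OF that] B(2) by blast
  moreover have "left_translate x (b j) = (\<Sum>i<m. fun_scale (\<rho> x $$ (i, j)) (b i))"
    if "j < m" "x \<in> carrier G" for j x
    using Lb[OF that(2,1)] unfolding comb_def .
  ultimately show ?thesis by (intro exI[of _ m] exI[of _ \<rho>] exI[of _ b]) simp
qed

text \<open>
  Let \<open>T\<close> be the operator \<open>(Tw)(z) = \<Sum>\<^sub>x f(x) w(xz)\<close>.  It combines translations with a class function as
  coefficients, so by hypothesis it kills every irreducible subspace of the functions on the group.  Its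
  adjoint has the functions \<open>h\<^sub>z(y) = f(z\<inverse>y)\<^sup>*\<close> as a spanning set of its image.  If \<open>f\<close> is nonzero, this
  image is a nonzero invariant space and contains an irreducible subspace.  A vector of that subspace
  is killed by \<open>T\<close>, so it is orthogonal to the image of the adjoint, in particular to itself, and vanishes.
\<close>
theorem class_function_eq_0_if_orthogonal_to_irreducible_characters:
  assumes conj: "\<And>x y. x \<in> carrier G \<Longrightarrow> y \<in> carrier G \<Longrightarrow> f (y \<otimes> x \<otimes> inv y) = f x"
    and orth: "\<And>\<chi>. \<chi> \<in> irreducible_characters G \<Longrightarrow> (\<Sum>x\<in>carrier G. f x * \<chi> (inv x)) = 0"
    and x: "x \<in> carrier G"
  shows "f x = 0"
proof (rule ccontr)
  assume fx: "f x \<noteq> 0"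
  define h where "h = (\<lambda>z y. if y \<in> carrier G then cnj (f (inv z \<otimes> y)) else 0)"
  define F where "F = h ` carrier G"
  have supp: "s y = 0" if "s \<in> funs.span F" "y \<notin> carrier G" for s y
    using that(1) by (induction rule: funs.span_induct_alt)
      (use that(2) in \<open>auto simp: F_def h_def fun_scale_def\<close>)
  have h_translate: "left_translate x (h z) = h (x \<otimes> z)" if "x \<in> carrier G" "z \<in> carrier G" for x z
    using that by (auto simp: left_translate_def h_def fun_eq_iff inv_mult_group m_assoc)
  have invF: "left_translate x s \<in> funs.span F" if "x \<in> carrier G" "s \<in> funs.span F" for x s
    using that(1)
    by (intro span_left_translate_invariant[OF _ that(2)] funs.span_base) (auto simp: F_def h_translate)
  have "h \<one> x \<noteq> 0" using fx x by (simp add: h_def)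
  hence "h \<one> \<noteq> 0" by auto
  hence nz: "\<exists>s\<in>funs.span F. s \<noteq> 0" by (intro bexI[of _ "h \<one>"] funs.span_base) (auto simp: F_def)
  have "finite F" using finite_carrier by (simp add: F_def)
  hence "\<exists>n \<rho> b. irreducible_rep G n \<rho> \<and> (\<forall>j<n. b j \<in> funs.span F \<and> b j \<noteq> 0 \<and>
    (\<forall>x\<in>carrier G. left_translate x (b j) = (\<Sum>i<n. fun_scale (\<rho> x $$ (i, j)) (b i))))"
    by (rule invariant_function_space_contains_irreducible[OF _ nz]) (fact supp invF)+
  then obtain n \<rho> b where \<rho>: "irreducible_rep G n \<rho>" and bF: "\<And>j. j < n \<Longrightarrow> b j \<in> funs.span F"
    and b0: "\<And>j. j < n \<Longrightarrow> b j \<noteq> 0" and Lb: "\<And>x j. x \<in> carrier G \<Longrightarrow> j < n \<Longrightarrow>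
       left_translate x (b j) = (\<Sum>i<n. fun_scale (\<rho> x $$ (i, j)) (b i))"
    by blast
  have n: "0 < n" by (rule rep(1)[OF \<rho>])
  have "character G \<rho> \<in> irreducible_characters G" using \<rho> by (auto simp: irreducible_characters_def)
  note zero = class_function_annihilates_rep[OF \<rho> conj orth[OF this]]
  have T: "(\<Sum>x\<in>carrier G. f x * b 0 (x \<otimes> z)) = 0" if z: "z \<in> carrier G" for z
  proof -
    have "(\<Sum>x\<in>carrier G. f x * b 0 (x \<otimes> z)) = (\<Sum>x\<in>carrier G. f x * left_translate (inv x) (b 0) z)"
      using z by (intro sum.cong) (auto simp: left_translate_def)
    also have "\<dots> = (\<Sum>x\<in>carrier G. \<Sum>i<n. f x * \<rho> (inv x) $$ (i, 0) * b i z)"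
      by (intro sum.cong refl) (simp add: Lb n sum_fun_apply fun_scale_def sum_distrib_left mult.assoc)
    also have "\<dots> = (\<Sum>i<n. (\<Sum>x\<in>carrier G. f x * \<rho> (inv x) $$ (i, 0)) * b i z)"
      by (subst sum.swap) (simp add: sum_distrib_right)
    also have "\<dots> = 0" using n by (simp add: zero)
    finally show ?thesis .
  qed
  have "(\<Sum>y\<in>carrier G. b 0 y * cnj (s y)) = 0" if "s \<in> funs.span F" for s
    using that
  proof (induction rule: funs.span_induct_alt)
    case base
    show ?case by simp
  next
    case (step c s t)
    then obtain z where z: "z \<in> carrier G" "s = h z" by (auto simp: F_def)
    have "(\<Sum>y\<in>carrier G. b 0 y * cnj (s y)) = (\<Sum>y\<in>carrier G. b 0 y * f (inv z \<otimes> y))"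
      using z by (simp add: h_def)
    also have "\<dots> = (\<Sum>x\<in>carrier G. b 0 (x \<otimes> z) * f (inv z \<otimes> (x \<otimes> z)))"
      using sum_mult_right[OF z(1), of "\<lambda>y. b 0 y * f (inv z \<otimes> y)"] by simp
    also have "\<dots> = (\<Sum>x\<in>carrier G. f x * b 0 (x \<otimes> z))"
    proof (intro sum.cong refl)
      fix x assume x: "x \<in> carrier G"
      have "f (inv z \<otimes> (x \<otimes> z)) = f x" using conj[OF x, of "inv z"] x z(1) by (simp add: m_assoc)
      thus "b 0 (x \<otimes> z) * f (inv z \<otimes> (x \<otimes> z)) = f x * b 0 (x \<otimes> z)" by simp
    qed
    also have "\<dots> = 0" by (rule T[OF z(1)])
    finally have s0: "(\<Sum>y\<in>carrier G. b 0 y * cnj (s y)) = 0" .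
    have "(\<Sum>y\<in>carrier G. b 0 y * cnj ((fun_scale c s + t) y)) =
        cnj c * (\<Sum>y\<in>carrier G. b 0 y * cnj (s y)) + (\<Sum>y\<in>carrier G. b 0 y * cnj (t y))"
      by (simp add: fun_scale_def algebra_simps sum.distrib sum_distrib_left)
    thus ?case using s0 step.IH by simp
  qed
  from this[OF bF[OF n]] have "complex_of_real (\<Sum>y\<in>carrier G. (cmod (b 0 y))\<^sup>2) = 0"
    unfolding of_real_sum complex_norm_square .
  hence "(\<Sum>y\<in>carrier G. (cmod (b 0 y))\<^sup>2) = 0" by (simp only: of_real_eq_0_iff)
  hence "\<forall>y\<in>carrier G. b 0 y = 0"
    using finite_carrier by (subst (asm) sum_nonneg_eq_0_iff) auto
  hence "b 0 = 0" using supp[OF bF[OF n]] by (auto simp: fun_eq_iff)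
  thus False using b0[OF n] by simp
qed

end

section \<open>The distribution of commutators\<close>

definition commutator_count :: "('g, 'm) monoid_scheme \<Rightarrow> 'g \<Rightarrow> nat" where
  "commutator_count G x = card {(a, b) \<in> carrier G \<times> carrier G. commutator G a b = x}"

context finite_group
begin

lemma commutator_closed: "a \<in> carrier G \<Longrightarrow> b \<in> carrier G \<Longrightarrow> commutator G a b \<in> carrier G"
  by (simp add: commutator_def)

lemma inv_commutator: "a \<in> carrier G \<Longrightarrow> b \<in> carrier G \<Longrightarrow> inv (commutator G a b) = commutator G b a"
  by (simp add: commutator_def inv_mult_group m_assoc)

lemma commutator_conjugate:
  assumes "a \<in> carrier G" "b \<in> carrier G" "y \<in> carrier G"
  shows "commutator G (y \<otimes> a \<otimes> inv y) (y \<otimes> b \<otimes> inv y) = y \<otimes> commutator G a b \<otimes> inv y"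
proof -
  have cancel: "inv y \<otimes> (y \<otimes> z) = z" if "z \<in> carrier G" for z
    using that assms by (simp flip: m_assoc)
  show ?thesis using assms by (simp add: commutator_def inv_mult_group m_assoc cancel)
qed

lemma commutator_count_eq_sum:
  "of_nat (commutator_count G x) =
    (\<Sum>a\<in>carrier G. \<Sum>b\<in>carrier G. if commutator G a b = x then 1 else 0 :: 'c::semiring_1)"
proof -
  have "(\<Sum>a\<in>carrier G. \<Sum>b\<in>carrier G. if commutator G a b = x then 1 else 0 :: 'c) =
      (\<Sum>p\<in>carrier G \<times> carrier G. if commutator G (fst p) (snd p) = x then 1 else 0)"
    by (simp add: sum.cartesian_product case_prod_beta)
  also have "\<dots> = (\<Sum>p\<in>{p \<in> carrier G \<times> carrier G. commutator G (fst p) (snd p) = x}. 1)"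
    using finite_carrier by (subst sum.inter_filter) auto
  also have "\<dots> = of_nat (card {p \<in> carrier G \<times> carrier G. commutator G (fst p) (snd p) = x})"
    by simp
  also have "{p \<in> carrier G \<times> carrier G. commutator G (fst p) (snd p) = x} =
      {(a, b) \<in> carrier G \<times> carrier G. commutator G a b = x}" by auto
  finally show ?thesis by (simp add: commutator_count_def)
qed

lemma commutator_count_conjugate:
  assumes x: "x \<in> carrier G" and y: "y \<in> carrier G"
  shows "commutator_count G (y \<otimes> x \<otimes> inv y) = commutator_count G x"
proof -
  have "commutator_count G (y \<otimes> x \<otimes> inv y) =
      (\<Sum>a\<in>carrier G. \<Sum>b\<in>carrier G. if commutator G a b = y \<otimes> x \<otimes> inv y then 1 else 0)"
    using commutator_count_eq_sum[where ?'c = nat] by simp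
  also have "\<dots> = (\<Sum>a\<in>carrier G. \<Sum>b\<in>carrier G.
      if commutator G (y \<otimes> a \<otimes> inv y) (y \<otimes> b \<otimes> inv y) = y \<otimes> x \<otimes> inv y then 1 else 0)"
    by (subst sum_conjugate[OF y, symmetric], subst sum_conjugate[OF y, symmetric]) (rule refl)
  also have "\<dots> = (\<Sum>a\<in>carrier G. \<Sum>b\<in>carrier G. if commutator G a b = x then 1 else 0)"
    using x y by (intro sum.cong refl) (simp add: commutator_conjugate commutator_closed)
  also have "\<dots> = commutator_count G x"
    using commutator_count_eq_sum[where ?'c = nat] by simp
  finally show ?thesis .
qed

lemma sum_commutator_count:
  fixes F :: "'a \<Rightarrow> complex"
  shows "(\<Sum>x\<in>carrier G. of_nat (commutator_count G x) * F x) =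
    (\<Sum>a\<in>carrier G. \<Sum>b\<in>carrier G. F (commutator G a b))"
proof -
  have "(\<Sum>x\<in>carrier G. of_nat (commutator_count G x) * F x) =
      (\<Sum>x\<in>carrier G. \<Sum>a\<in>carrier G. \<Sum>b\<in>carrier G. if commutator G a b = x then F x else 0)"
    unfolding commutator_count_eq_sum sum_distrib_right by (intro sum.cong refl) simp
  also have "\<dots> = (\<Sum>a\<in>carrier G. \<Sum>b\<in>carrier G. \<Sum>x\<in>carrier G. if commutator G a b = x then F x else 0)"
    by (rule trans[OF sum.swap]) (intro sum.cong refl sum.swap)
  also have "\<dots> = (\<Sum>a\<in>carrier G. \<Sum>b\<in>carrier G. F (commutator G a b))"
    using finite_carrier by (intro sum.cong refl) (simp add: commutator_closed)
  finally show ?thesis .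
qed

lemma irreducible_character_conjugate:
  assumes "\<chi> \<in> irreducible_characters G" "x \<in> carrier G" "y \<in> carrier G"
  shows "\<chi> (y \<otimes> x \<otimes> inv y) = \<chi> x"
  using irreducible_character_commute[OF assms(1), of "y \<otimes> x" "inv y"] assms(2,3)
  by (simp flip: m_assoc)

text \<open>
  Both sides are class functions.  Against an irreducible character \<open>\<chi>\<close> both give \<open>|G|\<^sup>2 / \<chi>(1)\<close>, the left
  side because \<open>\<Sum>\<^sub>a\<^sub>,\<^sub>b \<chi>([b,a]) = |G| \<Sum>\<^sub>a \<chi>(a)\<chi>(a\<inverse>) / \<chi>(1)\<close>.
\<close>
theorem frobenius_commutator_formula:
  assumes fin: "finite (irreducible_characters G)" and x: "x \<in> carrier G"
  shows "of_nat (commutator_count G x) =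
    of_nat (order G) * (\<Sum>\<chi>\<in>irreducible_characters G. \<chi> x / \<chi> \<one>)"
proof -
  \<comment> \<open>The difference of the two sides is a class function orthogonal to all irreducible characters.\<close>
  define f where "f = (\<lambda>x. of_nat (commutator_count G x) -
    of_nat (order G) * (\<Sum>\<chi>\<in>irreducible_characters G. \<chi> x / \<chi> \<one>))"
  have "f x = 0"
  proof (rule class_function_eq_0_if_orthogonal_to_irreducible_characters[OF _ _ x])
    show "f (y \<otimes> x \<otimes> inv y) = f x" if "x \<in> carrier G" "y \<in> carrier G" for x y
      using that by (simp add: f_def commutator_count_conjugate irreducible_character_conjugate)
  next
    fix \<chi> assume \<chi>: "\<chi> \<in> irreducible_characters G"
    let ?o = "of_nat (order G) :: complex"
    have "(\<Sum>x\<in>carrier G. of_nat (commutator_count G x) * \<chi> (inv x)) =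
        (\<Sum>a\<in>carrier G. \<Sum>b\<in>carrier G. \<chi> (b \<otimes> a \<otimes> inv b \<otimes> inv a))"
      unfolding sum_commutator_count
      by (intro sum.cong refl) (simp add: inv_commutator, simp add: commutator_def)
    also have "\<dots> = ?o / \<chi> \<one> * (\<Sum>a\<in>carrier G. \<chi> a * \<chi> (inv a))"
      by (simp add: irreducible_character_average[OF \<chi>] sum_distrib_left mult.assoc)
    also have "\<dots> = ?o * ?o / \<chi> \<one>"
      by (simp add: irreducible_character_orthogonality[OF \<chi> \<chi>])
    finally have count: "(\<Sum>x\<in>carrier G. of_nat (commutator_count G x) * \<chi> (inv x)) = ?o * ?o / \<chi> \<one>" .
    have "(\<Sum>x\<in>carrier G. (?o * (\<Sum>\<psi>\<in>irreducible_characters G. \<psi> x / \<psi> \<one>)) * \<chi> (inv x)) =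
        (\<Sum>x\<in>carrier G. \<Sum>\<psi>\<in>irreducible_characters G. ?o / \<psi> \<one> * (\<psi> x * \<chi> (inv x)))"
      by (intro sum.cong refl) (simp add: sum_distrib_left sum_distrib_right mult_ac)
    also have "\<dots> = (\<Sum>\<psi>\<in>irreducible_characters G. ?o / \<psi> \<one> * (\<Sum>x\<in>carrier G. \<psi> x * \<chi> (inv x)))"
      by (subst sum.swap) (simp only: sum_distrib_left)
    also have "\<dots> = (\<Sum>\<psi>\<in>irreducible_characters G. if \<psi> = \<chi> then ?o / \<chi> \<one> * ?o else 0)"
      by (intro sum.cong refl) (simp add: irreducible_character_orthogonality \<chi>)
    also have "\<dots> = ?o * ?o / \<chi> \<one>" using fin \<chi> by simp
    finally show "(\<Sum>x\<in>carrier G. f x * \<chi> (inv x)) = 0"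
      using count by (simp add: f_def left_diff_distrib sum_subtractf)
  qed
  thus ?thesis by (simp add: f_def)
qed

text \<open>
  Averaging over conjugation does not change the sum, since \<open>C\<close> is a union of conjugacy classes.
\<close>
lemma sum_character_translate:
  assumes \<chi>: "\<chi> \<in> irreducible_characters G" and g: "g \<in> carrier G" and C: "C \<subseteq> carrier G"
    and conj: "\<And>h y. h \<in> C \<Longrightarrow> y \<in> carrier G \<Longrightarrow> y \<otimes> h \<otimes> inv y \<in> C"
  shows "(\<Sum>h\<in>C. \<chi> (h \<otimes> g)) = (\<Sum>h\<in>C. \<chi> h * \<chi> g / \<chi> \<one>)"
proof -
  let ?o = "of_nat (order G) :: complex"
  have "(\<Sum>h\<in>C. \<chi> (a \<otimes> h \<otimes> inv a \<otimes> g)) = (\<Sum>h\<in>C. \<chi> (h \<otimes> g))" if a: "a \<in> carrier G" for a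
  proof (rule sum.reindex_bij_witness[where i = "\<lambda>h. inv a \<otimes> h \<otimes> a" and j = "\<lambda>h. a \<otimes> h \<otimes> inv a"])
    fix h assume "h \<in> C"
    hence h: "h \<in> C" "h \<in> carrier G" using C by auto
    show "inv a \<otimes> (a \<otimes> h \<otimes> inv a) \<otimes> a = h" "a \<otimes> (inv a \<otimes> h \<otimes> a) \<otimes> inv a = h"
      using a h by (simp_all add: m_assoc) (simp_all flip: m_assoc)
    show "a \<otimes> h \<otimes> inv a \<in> C" using conj[OF h(1) a] .
    show "inv a \<otimes> h \<otimes> a \<in> C" using conj[OF h(1), of "inv a"] a by simp
  qed simp
  hence "?o * (\<Sum>h\<in>C. \<chi> (h \<otimes> g)) = (\<Sum>a\<in>carrier G. \<Sum>h\<in>C. \<chi> (a \<otimes> h \<otimes> inv a \<otimes> g))"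
    by (simp add: order_def)
  also have "\<dots> = (\<Sum>h\<in>C. \<Sum>a\<in>carrier G. \<chi> (a \<otimes> h \<otimes> inv a \<otimes> g))" by (rule sum.swap)
  also have "\<dots> = ?o * (\<Sum>h\<in>C. \<chi> h * \<chi> g / \<chi> \<one>)"
    unfolding sum_distrib_left using C g
    by (intro sum.cong refl) (auto simp: irreducible_character_average[OF \<chi>])
  finally show ?thesis using order_pos by simp
qed

text \<open>
  The condition \<open>[a,b]\<inverse>g = h\<close> means \<open>[a,b] = gh\<inverse>\<close>, which Frobenius' formula counts; summing over \<open>h\<close> in
  the inversion-closed set \<open>C\<close> allows \<open>h\<inverse>\<close> to be replaced by \<open>h\<close>.
\<close>
lemma card_commutator_translate:
  assumes fin: "finite (irreducible_characters G)" and g: "g \<in> carrier G" and C: "C \<subseteq> carrier G"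
    and conj: "\<And>h y. h \<in> C \<Longrightarrow> y \<in> carrier G \<Longrightarrow> y \<otimes> h \<otimes> inv y \<in> C"
    and invC: "\<And>h. h \<in> C \<Longrightarrow> inv h \<in> C"
  shows "of_nat (card {(a, b) \<in> carrier G \<times> carrier G. inv (commutator G a b) \<otimes> g \<in> C}) =
    of_nat (order G) * (\<Sum>h\<in>C. \<Sum>\<chi>\<in>irreducible_characters G. \<chi> h * \<chi> g / (\<chi> \<one>)\<^sup>2)"
proof -
  let ?o = "of_nat (order G) :: complex"
  let ?S = "\<lambda>x. {(a, b) \<in> carrier G \<times> carrier G. commutator G a b = x}"
  have finC: "finite C" using C finite_carrier by (rule finite_subset)
  have eq: "inv c \<otimes> g = h \<longleftrightarrow> c = g \<otimes> inv h" if "c \<in> carrier G" "h \<in> carrier G" for c h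
  proof
    assume "inv c \<otimes> g = h"
    hence "g \<otimes> inv h = g \<otimes> (inv g \<otimes> c)" using that g by (auto simp: inv_mult_group)
    thus "c = g \<otimes> inv h" using that g by (simp flip: m_assoc)
  next
    assume "c = g \<otimes> inv h"
    thus "inv c \<otimes> g = h" using that g by (simp add: inv_mult_group m_assoc)
  qed
  have "{(a, b) \<in> carrier G \<times> carrier G. inv (commutator G a b) \<otimes> g \<in> C} = (\<Union>h\<in>C. ?S (g \<otimes> inv h))"
    using C by (auto simp: eq[OF commutator_closed, symmetric] subset_iff)
  moreover have "card (\<Union>h\<in>C. ?S (g \<otimes> inv h)) = (\<Sum>h\<in>C. card (?S (g \<otimes> inv h)))"
  proof (rule card_UN_disjoint[OF finC])
    show "\<forall>h\<in>C. finite (?S (g \<otimes> inv h))"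
      using finite_carrier by (auto intro: finite_subset[of _ "carrier G \<times> carrier G"])
    have "h = h'" if "h \<in> C" "h' \<in> C" "g \<otimes> inv h = g \<otimes> inv h'" for h h'
    proof -
      have hh: "h \<in> carrier G" "h' \<in> carrier G" using that C by auto
      have "inv h = inv h'" using that(3) g hh by simp
      thus ?thesis using hh by (metis inv_inv)
    qed
    thus "\<forall>h\<in>C. \<forall>h'\<in>C. h \<noteq> h' \<longrightarrow> ?S (g \<otimes> inv h) \<inter> ?S (g \<otimes> inv h') = {}" by auto
  qed
  ultimately have "card {(a, b) \<in> carrier G \<times> carrier G. inv (commutator G a b) \<otimes> g \<in> C} =
      (\<Sum>h\<in>C. commutator_count G (g \<otimes> inv h))" by (simp add: commutator_count_def)
  also have "\<dots> = (\<Sum>h\<in>C. commutator_count G (g \<otimes> h))"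
    by (rule sum.reindex_bij_witness[where i = "\<lambda>h. inv h" and j = "\<lambda>h. inv h"]) (use C invC in auto)
  finally have "of_nat (card {(a, b) \<in> carrier G \<times> carrier G. inv (commutator G a b) \<otimes> g \<in> C}) =
      (\<Sum>h\<in>C. ?o * (\<Sum>\<chi>\<in>irreducible_characters G. \<chi> (g \<otimes> h) / \<chi> \<one>))"
    using C g by (simp add: frobenius_commutator_formula[OF fin] subset_iff)
  also have "\<dots> = (\<Sum>h\<in>C. \<Sum>\<chi>\<in>irreducible_characters G. ?o * (\<chi> (h \<otimes> g) / \<chi> \<one>))"
    unfolding sum_distrib_left using C g
    by (intro sum.cong refl) (auto simp: irreducible_character_commute[of _ g])
  also have "\<dots> = (\<Sum>\<chi>\<in>irreducible_characters G. ?o / \<chi> \<one> * (\<Sum>h\<in>C. \<chi> (h \<otimes> g)))"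
    by (subst sum.swap) (simp add: sum_distrib_left)
  also have "\<dots> = (\<Sum>\<chi>\<in>irreducible_characters G. ?o / \<chi> \<one> * (\<Sum>h\<in>C. \<chi> h * \<chi> g / \<chi> \<one>))"
    by (intro sum.cong refl) (simp only: sum_character_translate[OF _ g C conj])
  also have "\<dots> = (\<Sum>h\<in>C. \<Sum>\<chi>\<in>irreducible_characters G. ?o * (\<chi> h * \<chi> g / (\<chi> \<one>)\<^sup>2))"
    by (subst sum.swap) (simp add: sum_distrib_left power2_eq_square)
  finally show ?thesis by (simp add: sum_distrib_left)
qed

end

section \<open>Moments and their leading term\<close>

lemma tendsto_powr_at_top_0:
  fixes x :: real
  assumes "0 \<le> x" "x < 1"
  shows "((\<lambda>t. x powr t) \<longlongrightarrow> 0) at_top"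
proof (cases "x = 0")
  case False
  hence x: "x > 0" "ln x < 0" using assms by auto
  have "((\<lambda>t. exp (t * ln x)) \<longlongrightarrow> 0) at_top"
    using x(2) by real_asymp
  thus ?thesis using x by (simp add: powr_def)
qed simp

text \<open>
  Divide by the power \<open>r\<^sub>q\<^sup>t\<close> of the first base with nonzero coefficient: the quotient \<open>E\<close> tends to that
  coefficient, since all later bases are strictly smaller.  As \<open>E\<close> has a nonzero limit, \<open>E\<^sup>1\<^sup>/\<^sup>t\<close> tends to one.
  If no coefficient before the last is nonzero the sum vanishes identically, because the last base is
  zero and \<open>0 powr t = 0\<close>.
\<close>
lemma powr_sum_leading_term:
  fixes p r :: "nat \<Rightarrow> real"
  assumes r: "strict_antimono_on {0..l} r" and rl: "r l = 0"
  defines "D \<equiv> \<lambda>t. \<Sum>q\<le>l. p q * r q powr t"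
  shows "\<exists>q\<le>l. ((\<lambda>t. D t powr (1 / t)) \<longlongrightarrow> r q) at_top \<and> D \<sim>[at_top] (\<lambda>t. p q * r q powr t)"
proof (cases "\<exists>q<l. p q \<noteq> 0")
  case False
  have "D t = 0" for t
    unfolding D_def using False rl by (intro sum.neutral) (auto simp: le_less)
  hence "D = (\<lambda>t. 0)" by (rule ext)
  thus ?thesis using rl by (intro exI[of _ l]) auto
next
  case True
  define q where "q = (LEAST q. p q \<noteq> 0)"
  obtain j where j: "j < l" "p j \<noteq> 0" using True by blast
  have q: "q < l" "p q \<noteq> 0"
    using Least_le[of "\<lambda>q. p q \<noteq> 0", OF j(2)] LeastI[of "\<lambda>q. p q \<noteq> 0", OF j(2)] j(1)
    by (simp_all add: q_def)
  have least: "p j = 0" if "j < q" for j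
    using not_less_Least[of j "\<lambda>q. p q \<noteq> 0"] that by (simp add: q_def)
  have dec: "r j < r i" if "i < j" "j \<le> l" for i j
    using monotone_onD[OF r, of i j] that by auto
  have rq: "r q > 0" using dec[OF q(1)] rl by simp
  have nonneg: "r j \<ge> 0" if "j \<le> l" for j
    using dec[of j l] that rl by (cases "j = l") auto
  define E where "E = (\<lambda>t. \<Sum>j\<le>l. p j * (r j / r q) powr t)"
  have DE: "D t = r q powr t * E t" for t
    unfolding D_def E_def sum_distrib_left using rq nonneg
    by (intro sum.cong refl) (simp add: powr_divide)
  have "((\<lambda>t. p j * (r j / r q) powr t) \<longlongrightarrow> (if j = q then p q else 0)) at_top" if "j \<le> l" for j
  proof (cases j q rule: linorder_cases)
    case less
    thus ?thesis using least by simp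
  next
    case equal
    thus ?thesis using rq by simp
  next
    case greater
    have "((\<lambda>t. (r j / r q) powr t) \<longlongrightarrow> 0) at_top"
      using dec[OF greater that] nonneg[OF that] rq by (intro tendsto_powr_at_top_0) auto
    from tendsto_mult_left[OF this, of "p j"] show ?thesis using greater by simp
  qed
  hence "(E \<longlongrightarrow> (\<Sum>j\<le>l. if j = q then p q else 0)) at_top"
    unfolding E_def by (intro tendsto_sum) auto
  hence E: "(E \<longlongrightarrow> p q) at_top" using q(1) by simp
  have "((\<lambda>t. D t / (p q * r q powr t)) \<longlongrightarrow> 1) at_top"
  proof -
    have "((\<lambda>t. E t / p q) \<longlongrightarrow> p q / p q) at_top" using q(2) by (intro tendsto_divide E) auto
    thus ?thesis using q(2) rq by (simp add: DE)
  qed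
  hence asymp: "D \<sim>[at_top] (\<lambda>t. p q * r q powr t)" by (rule asymp_equivI')
  have "((\<lambda>t::real. 1 / t) \<longlongrightarrow> 0) at_top" by real_asymp
  from tendsto_mult_left[OF tendsto_powr[OF E this q(2)], of "r q"]
  have "((\<lambda>t. r q * E t powr (1 / t)) \<longlongrightarrow> r q) at_top" using q(2) by simp
  moreover have "\<forall>\<^sub>F t in at_top. r q * E t powr (1 / t) = D t powr (1 / t)"
    using eventually_gt_at_top[of 0]
  proof eventually_elim
    case (elim t)
    have "D t powr (1 / t) = (r q powr t) powr (1 / t) * E t powr (1 / t)"
      unfolding DE by (rule powr_mult)
    also have "(r q powr t) powr (1 / t) = r q" using elim rq by (simp add: powr_powr)
    finally show ?case by simp
  qed
  ultimately have "((\<lambda>t. D t powr (1 / t)) \<longlongrightarrow> r q) at_top" by (rule Lim_transform_eventually)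
  thus ?thesis using asymp q(1) by (intro exI[of _ q]) auto
qed

lemma asymp_equiv_of_real:
  fixes f g :: "'a \<Rightarrow> real"
  assumes "f \<sim>[F] g"
  shows "(\<lambda>x. complex_of_real (f x)) \<sim>[F] (\<lambda>x. complex_of_real (g x))"
proof -
  have "((\<lambda>x. complex_of_real (if f x = 0 \<and> g x = 0 then 1 else f x / g x)) \<longlongrightarrow> of_real 1) F"
    using assms unfolding asymp_equiv_def by (rule tendsto_of_real)
  thus ?thesis unfolding asymp_equiv_def by (simp add: if_distrib cong: if_cong)
qed

context finite_group
begin

lemma finite_pairs: "finite (carrier G \<times> carrier G)" "carrier G \<times> carrier G \<noteq> {}"
  using finite_carrier by auto

lemma prob_uniform_pairs:
  "measure_pmf.prob (uniform_pairs G) {p. Q p} =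
    card {p \<in> carrier G \<times> carrier G. Q p} / (real (order G))\<^sup>2"
proof -
  have "(carrier G \<times> carrier G) \<inter> {p. Q p} = {p \<in> carrier G \<times> carrier G. Q p}" by auto
  thus ?thesis
    using finite_pairs by (simp add: measure_pmf_of_set card_cartesian_product order_def power2_eq_square)
qed

text \<open>
  Each pair is counted in exactly one summand, because the listed values are distinct and all smaller
  than \<open>n\<close>.
\<close>
lemma normalized_moment_eq:
  fixes \<gamma> :: "nat \<Rightarrow> real"
  assumes range: "\<And>p. p \<in> carrier G \<times> carrier G \<Longrightarrow> cmod (xi G chi g p) \<in> insert (real n) (\<gamma> ` {..l})"
    and inj: "inj_on \<gamma> {..l}" and nonneg: "\<And>q. q \<le> l \<Longrightarrow> 0 \<le> \<gamma> q" and less: "\<And>q. q \<le> l \<Longrightarrow> \<gamma> q < real n"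
  shows "normalized_moment G chi n g t =
    measure_pmf.prob (uniform_pairs G) {p. cmod (xi G chi g p) = real n} +
    (\<Sum>q\<le>l. measure_pmf.prob (uniform_pairs G) {p. cmod (xi G chi g p) = \<gamma> q} * (\<gamma> q / real n) powr t)"
proof -
  let ?P = "carrier G \<times> carrier G" and ?x = "\<lambda>p. cmod (xi G chi g p)"
  have n: "real n > 0" using less[of 0] nonneg[of 0] by simp
  have split: "?x p powr t / real n powr t =
      (if ?x p = real n then 1 else 0) + (\<Sum>q\<le>l. if ?x p = \<gamma> q then (\<gamma> q / real n) powr t else 0)"
    if p: "p \<in> ?P" for p
  proof (cases "?x p = real n")
    case True
    hence "(\<Sum>q\<le>l. if ?x p = \<gamma> q then (\<gamma> q / real n) powr t else 0) = 0"
      using less by (intro sum.neutral) (metis atMost_iff less_irrefl)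
    thus ?thesis using True n by simp
  next
    case False
    then obtain q where q: "q \<le> l" "?x p = \<gamma> q" using range[OF p] by auto
    have "(\<Sum>j\<le>l. if ?x p = \<gamma> j then (\<gamma> j / real n) powr t else 0) =
        (\<Sum>j\<le>l. if q = j then (\<gamma> j / real n) powr t else 0)"
      using q inj by (intro sum.cong) (auto simp: inj_on_eq_iff)
    thus ?thesis using False q nonneg[OF q(1)] n by (simp add: powr_divide)
  qed
  have count: "(\<Sum>p\<in>?P. if Q p then c else 0) = c * card {p \<in> ?P. Q p}" for Q and c :: real
    using finite_pairs(1) by (simp add: sum.inter_filter[symmetric])
  have "normalized_moment G chi n g t = (\<Sum>p\<in>?P. ?x p powr t / real n powr t) / (real (order G))\<^sup>2"
    using finite_pairs unfolding normalized_moment_def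
    by (subst integral_pmf_of_set)
       (simp_all add: card_cartesian_product order_def power2_eq_square sum_divide_distrib mult_ac)
  also have "(\<Sum>p\<in>?P. ?x p powr t / real n powr t) =
      (\<Sum>p\<in>?P. if ?x p = real n then 1 else 0) +
      (\<Sum>q\<le>l. \<Sum>p\<in>?P. if ?x p = \<gamma> q then (\<gamma> q / real n) powr t else 0)"
    by (subst sum.swap) (simp only: split sum.distrib cong: sum.cong)
  finally show ?thesis
    unfolding prob_uniform_pairs count
    by (simp add: add_divide_distrib sum_divide_distrib mult.commute)
qed

end


section \<open>Moments of character values at commutator translates\<close>

theorem theorem5p1:
  fixes G :: "('g, 'm) monoid_scheme"
    and n k l :: nat
    and \<rho> :: "'g \<Rightarrow> complex mat"
    and chi :: "'g \<Rightarrow> complex"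
    and \<gamma> :: "nat \<Rightarrow> real"
    and \<psi> :: "nat \<Rightarrow> 'g \<Rightarrow> complex"
  assumes "group G" and "finite (carrier G)" and "\<not> comm_group G" and "center G = {\<one>\<^bsub>G\<^esub>}"
    and "n > 1" and "irreducible_rep G n \<rho>" and "inj_on \<rho> (carrier G)"
    and "chi = character G \<rho>"
    and "(\<lambda>g. cmod (chi g)) ` carrier G = insert (real n) (\<gamma> ` {0..l})"
    and "real n > \<gamma> 0" and "strict_antimono_on {0..l} \<gamma>" and "\<gamma> l = 0" and "\<gamma> 0 > 0"
    and "bij_betw \<psi> {1..k} (irreducible_characters G)"
    and "g \<in> carrier G"
  shows "(\<forall>t\<ge>0. normalized_moment G chi n g t \<ge> commutator_density G g)
    \<and> (normalized_moment G chi n g \<longlongrightarrow> commutator_density G g) at_top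
    \<and> (\<exists>q\<le>l.
          ((\<lambda>t. (normalized_moment G chi n g t - commutator_density G g) powr (1 / t))
             \<longlongrightarrow> \<gamma> q / real n) at_top
        \<and> (\<lambda>t. complex_of_real (normalized_moment G chi n g t - commutator_density G g))
             \<sim>[at_top] (\<lambda>t. c_coeff G chi \<gamma> k \<psi> q g * complex_of_real ((\<gamma> q / real n) powr t)))
    \<and> (\<forall>q\<le>l.
          c_coeff G chi \<gamma> k \<psi> q g =
            complex_of_real (measure_pmf.prob (uniform_pairs G) {p. cmod (xi G chi g p) = \<gamma> q})
        \<and> c_coeff G chi \<gamma> k \<psi> q g =
            1 / of_nat (order G) * (\<Sum>i=1..k. \<psi> i g / (\<psi> i \<one>\<^bsub>G\<^esub>)\<^sup>2 * iota G chi \<gamma> \<psi> i q)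
        \<and> c_coeff G chi \<gamma> k \<psi> q g =
            1 / of_nat (order G) *
              (\<Sum>h\<in>modulus_class G chi \<gamma> q. \<Sum>i=1..k. \<psi> i h * \<psi> i g / (\<psi> i \<one>\<^bsub>G\<^esub>)\<^sup>2))"
proof -
  note g = assms(15) and irr = assms(6) and anti = assms(11) and bij = assms(14)
  interpret finite_group G
    using assms(1,2) by (simp add: finite_group_def finite_group_axioms_def)
  have chi: "chi \<in> irreducible_characters G"
    using irr by (auto simp: irreducible_characters_def assms(8))
  have fin: "finite (irreducible_characters G)"
    using bij_betw_finite[OF bij] by simp
  define p where "p = (\<lambda>q. measure_pmf.prob (uniform_pairs G) {p. cmod (xi G chi g p) = \<gamma> q})"
  define M where "M = normalized_moment G chi n g"
  define c where "c = commutator_density G g"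
  have dec: "\<gamma> j < \<gamma> i" if "i < j" "j \<le> l" for i j
    using monotone_onD[OF anti, of i j] that by auto
  have nonneg: "0 \<le> \<gamma> q" if "q \<le> l" for q
    using dec[of q l] that assms(12) by (cases "q = l") auto
  have less: "\<gamma> q < real n" if "q \<le> l" for q
    using dec[of 0 q] that assms(10) by (cases "q = 0") auto
  have inj: "inj_on \<gamma> {..l}"
    by (rule linorder_inj_onI) (use dec in fastforce)+
  have xi: "xi G chi g (a, b) = chi (inv\<^bsub>G\<^esub> (commutator G a b) \<otimes>\<^bsub>G\<^esub> g)" for a b
    by (simp add: xi_def)
  have closed: "inv\<^bsub>G\<^esub> (commutator G a b) \<otimes>\<^bsub>G\<^esub> g \<in> carrier G" if "a \<in> carrier G" "b \<in> carrier G" for a b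
    using commutator_closed[OF that] g by simp

  have one: "x = \<one>\<^bsub>G\<^esub>" if "x \<in> carrier G" "cmod (chi x) = real n" for x
    using faithful_central_if_cmod_character_max[OF irr assms(7)] that assms(4) by (auto simp: assms(8))
  have max_iff: "cmod (chi (inv\<^bsub>G\<^esub> (commutator G a b) \<otimes>\<^bsub>G\<^esub> g)) = real n \<longleftrightarrow> commutator G a b = g"
    if ab: "a \<in> carrier G" "b \<in> carrier G" for a b
  proof
    assume "cmod (chi (inv\<^bsub>G\<^esub> (commutator G a b) \<otimes>\<^bsub>G\<^esub> g)) = real n"
    hence "inv\<^bsub>G\<^esub> (commutator G a b) \<otimes>\<^bsub>G\<^esub> g = \<one>\<^bsub>G\<^esub>" using one closed[OF ab] by blast
    thus "commutator G a b = g"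
      using commutator_closed[OF ab] g by (metis inv_closed inv_equality inv_inv inv_comm)
  next
    assume "commutator G a b = g"
    thus "cmod (chi (inv\<^bsub>G\<^esub> (commutator G a b) \<otimes>\<^bsub>G\<^esub> g)) = real n"
      using g character_one[OF irr] by (simp add: assms(8))
  qed
  have density: "measure_pmf.prob (uniform_pairs G) {p. cmod (xi G chi g p) = real n} = c"
  proof -
    have "{p \<in> carrier G \<times> carrier G. cmod (xi G chi g p) = real n} =
        {(x, y) \<in> carrier G \<times> carrier G. commutator G x y = g}"
    proof (rule Set.set_eqI)
      fix x
      show "x \<in> {p \<in> carrier G \<times> carrier G. cmod (xi G chi g p) = real n} \<longleftrightarrow>
          x \<in> {(x, y) \<in> carrier G \<times> carrier G. commutator G x y = g}"
        by (cases x) (simp add: xi max_iff cong: conj_cong)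
    qed
    thus ?thesis by (simp add: prob_uniform_pairs c_def commutator_density_def)
  qed

  have M: "M t = c + (\<Sum>q\<le>l. p q * (\<gamma> q / real n) powr t)" for t
    unfolding M_def p_def density[symmetric]
  proof (rule normalized_moment_eq[OF _ inj nonneg less])
    fix x assume "x \<in> carrier G \<times> carrier G"
    then obtain a b where "x = (a, b)" "a \<in> carrier G" "b \<in> carrier G" by auto
    hence "cmod (xi G chi g x) \<in> (\<lambda>g. cmod (chi g)) ` carrier G" using closed by (simp add: xi)
    thus "cmod (xi G chi g x) \<in> insert (real n) (\<gamma> ` {..l})" unfolding assms(9) by (simp add: atLeast0AtMost)
  qed
  have p_nonneg: "p q \<ge> 0" for q by (simp add: p_def)
  have n: "real n > 0" using assms(5) by simp

  have i: "\<forall>t\<ge>0. M t \<ge> c" by (simp add: M sum_nonneg p_nonneg)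

  have "((\<lambda>t. c + (\<Sum>q\<le>l. p q * (\<gamma> q / real n) powr t)) \<longlongrightarrow> c + (\<Sum>q\<le>l. p q * 0)) at_top"
    using nonneg less n by (intro tendsto_intros tendsto_powr_at_top_0) auto
  hence ii: "(M \<longlongrightarrow> c) at_top" by (simp add: M[abs_def])

  have coeff: "c_coeff G chi \<gamma> k \<psi> q g = complex_of_real (p q)" if "q \<le> l" for q
  proof -
    let ?C = "modulus_class G chi \<gamma> q"
    have set_eq: "{x \<in> carrier G \<times> carrier G. cmod (xi G chi g x) = \<gamma> q} =
        {(a, b) \<in> carrier G \<times> carrier G. inv\<^bsub>G\<^esub> (commutator G a b) \<otimes>\<^bsub>G\<^esub> g \<in> ?C}"
      using closed by (auto simp: xi modulus_class_def)
    have count: "of_nat (card {x \<in> carrier G \<times> carrier G. cmod (xi G chi g x) = \<gamma> q}) =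
        of_nat (order G) * (\<Sum>h\<in>?C. \<Sum>\<chi>\<in>irreducible_characters G. \<chi> h * \<chi> g / (\<chi> \<one>\<^bsub>G\<^esub>)\<^sup>2)"
      unfolding set_eq
    proof (rule card_commutator_translate[OF fin g])
      show "?C \<subseteq> carrier G" by (auto simp: modulus_class_def)
      show "y \<otimes>\<^bsub>G\<^esub> h \<otimes>\<^bsub>G\<^esub> inv\<^bsub>G\<^esub> y \<in> ?C" if "h \<in> ?C" "y \<in> carrier G" for h y
        using that by (simp add: modulus_class_def irreducible_character_conjugate[OF chi])
      show "inv\<^bsub>G\<^esub> h \<in> ?C" if "h \<in> ?C" for h
        using that by (simp add: modulus_class_def irreducible_character_inv[OF chi])
    qed
    have "(\<Sum>i=1..k. \<psi> i h * \<psi> i g / (\<psi> i \<one>\<^bsub>G\<^esub>)\<^sup>2) =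
        (\<Sum>\<chi>\<in>irreducible_characters G. \<chi> h * \<chi> g / (\<chi> \<one>\<^bsub>G\<^esub>)\<^sup>2)" for h
      by (rule sum.reindex_bij_betw[OF bij])
    hence "c_coeff G chi \<gamma> k \<psi> q g = 1 / of_nat (order G) *
        (\<Sum>h\<in>?C. \<Sum>\<chi>\<in>irreducible_characters G. \<chi> h * \<chi> g / (\<chi> \<one>\<^bsub>G\<^esub>)\<^sup>2)"
      by (simp add: c_coeff_def)
    also have "\<dots> = of_nat (card {x \<in> carrier G \<times> carrier G. cmod (xi G chi g x) = \<gamma> q}) / (of_nat (order G))\<^sup>2"
      unfolding count using order_pos by (simp add: power2_eq_square)
    also have "\<dots> = complex_of_real (p q)" by (simp add: p_def prob_uniform_pairs)
    finally show ?thesis .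
  qed

  have "strict_antimono_on {0..l} (\<lambda>q. \<gamma> q / real n)"
    using n dec by (intro monotone_onI) (auto simp: divide_strict_right_mono)
  from powr_sum_leading_term[where p = p, OF this]
  obtain q where q: "q \<le> l"
    "((\<lambda>t. (\<Sum>q\<le>l. p q * (\<gamma> q / real n) powr t) powr (1 / t)) \<longlongrightarrow> \<gamma> q / real n) at_top"
    "(\<lambda>t. \<Sum>q\<le>l. p q * (\<gamma> q / real n) powr t) \<sim>[at_top] (\<lambda>t. p q * (\<gamma> q / real n) powr t)"
    using assms(12) by auto
  have D: "M t - c = (\<Sum>q\<le>l. p q * (\<gamma> q / real n) powr t)" for t by (simp add: M)
  have iii: "\<exists>q\<le>l. ((\<lambda>t. (M t - c) powr (1 / t)) \<longlongrightarrow> \<gamma> q / real n) at_top \<and>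
      (\<lambda>t. complex_of_real (M t - c)) \<sim>[at_top]
      (\<lambda>t. c_coeff G chi \<gamma> k \<psi> q g * complex_of_real ((\<gamma> q / real n) powr t))"
  proof (intro exI[of _ q] conjI)
    show "(\<lambda>t. complex_of_real (M t - c)) \<sim>[at_top]
        (\<lambda>t. c_coeff G chi \<gamma> k \<psi> q g * complex_of_real ((\<gamma> q / real n) powr t))"
      unfolding coeff[OF q(1)] D of_real_mult[symmetric] by (rule asymp_equiv_of_real[OF q(3)])
  qed (use q in \<open>simp_all add: D\<close>)

  have iota: "c_coeff G chi \<gamma> k \<psi> q g =
      1 / of_nat (order G) * (\<Sum>i=1..k. \<psi> i g / (\<psi> i \<one>\<^bsub>G\<^esub>)\<^sup>2 * iota G chi \<gamma> \<psi> i q)" for q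
    unfolding c_coeff_def iota_def sum_distrib_left[of "_ / _ :: complex"]
    by (subst sum.swap) (simp add: sum_distrib_left mult_ac)
  have iv: "\<forall>q\<le>l.
          c_coeff G chi \<gamma> k \<psi> q g =
            complex_of_real (measure_pmf.prob (uniform_pairs G) {p. cmod (xi G chi g p) = \<gamma> q})
        \<and> c_coeff G chi \<gamma> k \<psi> q g =
            1 / of_nat (order G) * (\<Sum>i=1..k. \<psi> i g / (\<psi> i \<one>\<^bsub>G\<^esub>)\<^sup>2 * iota G chi \<gamma> \<psi> i q)
        \<and> c_coeff G chi \<gamma> k \<psi> q g =
            1 / of_nat (order G) *
              (\<Sum>h\<in>modulus_class G chi \<gamma> q. \<Sum>i=1..k. \<psi> i h * \<psi> i g / (\<psi> i \<one>\<^bsub>G\<^esub>)\<^sup>2)"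
    by (intro allI impI conjI coeff[unfolded p_def] iota c_coeff_def)
  from i ii iii iv show ?thesis unfolding M_def c_def by (intro conjI)
qed

end
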